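(* Let $M$ be a smooth manifold of dimension $m$, with tangent bundle $\tau_M\colon TM\to M$, and let $P\subset TM$ be an open subset projecting onto $M$. Suppose we have $m$ smooth functions $f^1,\dots,f^m\colon P\to\mathbb{R}$ whose fibre derivatives $\mathcal{F}f^1,\dots,\mathcal{F}f^m\colon P\to T^*M$ are linearly independent at each point of $P$. Then around any point $v\in P$ there exists a unique local vector field $Z$ satisfying the second-order condition and for which the functions $f^1,\dots,f^m$ are constants of the motion.
   Context: All manifolds and maps are $C^\infty$. The fibre derivative of $f\colon P\to\mathbb{R}$ is the map $\mathcal{F}f\colon P\to T^*M$ sending $v\in P\cap T_xM$ to the differential at $v$ of $f|_{P\cap T_xM}$, regarded as an element of $T^*_xM$; in natural coordinates $(q^i,v^i)$ its components are $\partial f/\partial v^i$. A vector field $Z$ on an open subset of $TM$ satisfies the second-order condition if $T\tau_M\circ Z=\mathrm{Id}$ on that subset (in natural coordinates, $Z=v^i\,\partial/\partial q^i+Z^i(q,v)\,\partial/\partial v^i$). A function $f$ is a constant of the motion for $Z$ if it is constant along every integral curve of $Z$, equivalently if the Lie derivative $\mathcal{L}_Zf$ is zero. A local vector field around $v$ is a vector field defined on an open neighbourhood of $v$ in $P$. *)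

theory Defs
  imports "HOL-Analysis.Analysis"
begin

section \<open>Smooth functions between open subsets of finite-dimensional vector spaces\<close>

text \<open>
  Differentiability classes are expressed through iterated directional derivatives. The set S is
  meant to be open. On a finite-dimensional domain, continuity of all directional derivatives
  is the same as continuity of the Frechet derivative.
\<close>

primrec Ck_on ::
  "nat \<Rightarrow> 'e::real_normed_vector set \<Rightarrow> ('e \<Rightarrow> 'f::real_normed_vector) \<Rightarrow> bool" where
  "Ck_on 0 S f \<longleftrightarrow> continuous_on S f"
| "Ck_on (Suc k) S f \<longleftrightarrow>
     (\<forall>x\<in>S. f differentiable (at x)) \<and> (\<forall>h. Ck_on k S (\<lambda>x. frechet_derivative f (at x) h))"

definition smooth_on ::
  "'e::real_normed_vector set \<Rightarrow> ('e \<Rightarrow> 'f::real_normed_vector) \<Rightarrow> bool" where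
  "smooth_on S f \<longleftrightarrow> (\<forall>k. Ck_on k S f)"


section \<open>Smooth manifolds\<close>

text \<open>
  A chart is a pair of its domain and its coordinate map; the values of the coordinate map outside
  the domain are irrelevant. A manifold is given by an atlas, which is not required to be maximal.
  The underlying set is the union of the chart domains, and the topology is the one
  induced by the charts.
\<close>

type_synonym ('a, 'e) chart = "'a set \<times> ('a \<Rightarrow> 'e)"

type_synonym ('a, 'e) atlas = "('a, 'e) chart set"

definition carrier :: "('a, 'e) atlas \<Rightarrow> 'a set" where
  "carrier A = (\<Union>c\<in>A. fst c)"

definition charts_at :: "('a, 'e) atlas \<Rightarrow> 'a \<Rightarrow> ('a, 'e) chart set" where
  "charts_at A p = {c \<in> A. p \<in> fst c}"

definition chart_inv :: "('a, 'e) chart \<Rightarrow> 'e \<Rightarrow> 'a" where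
  "chart_inv c = inv_into (fst c) (snd c)"

definition transition :: "('a, 'e) chart \<Rightarrow> ('a, 'f) chart \<Rightarrow> 'e \<Rightarrow> 'f" where
  "transition c d = snd d \<circ> chart_inv c"

definition smooth_atlas :: "('a, 'e::real_normed_vector) atlas \<Rightarrow> bool" where
  "smooth_atlas A \<longleftrightarrow>
     (\<forall>c\<in>A. inj_on (snd c) (fst c)) \<and>
     (\<forall>c\<in>A. \<forall>d\<in>A. open (snd c ` (fst c \<inter> fst d)) \<and>
                    smooth_on (snd c ` (fst c \<inter> fst d)) (transition c d))"

definition atlas_topology :: "('a, 'e::topological_space) atlas \<Rightarrow> 'a topology" where
  "atlas_topology A =
     topology (\<lambda>S. S \<subseteq> carrier A \<and> (\<forall>c\<in>A. open (snd c ` (S \<inter> fst c))))"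

lemma openin_atlas_topology:
  assumes "\<And>c. c \<in> A \<Longrightarrow> inj_on (snd c) (fst c)"
  shows "openin (atlas_topology A) S \<longleftrightarrow>
           S \<subseteq> carrier A \<and> (\<forall>c\<in>A. open (snd c ` (S \<inter> fst c)))"
proof -
  have "istopology (\<lambda>S. S \<subseteq> carrier A \<and> (\<forall>c\<in>A. open (snd c ` (S \<inter> fst c))))"
    unfolding istopology_def
  proof (intro conjI allI impI ballI; (elim conjE)?)
    fix S T c
    assume c: "c \<in> A" and S: "\<forall>c\<in>A. open (snd c ` (S \<inter> fst c))"
      and T: "\<forall>c\<in>A. open (snd c ` (T \<inter> fst c))"
    have "snd c ` (S \<inter> T \<inter> fst c) = snd c ` (S \<inter> fst c) \<inter> snd c ` (T \<inter> fst c)"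
      using assms[OF c] by (auto simp: inj_on_def)
    then show "open (snd c ` (S \<inter> T \<inter> fst c))"
      using S T c by auto
  next
    fix K c
    assume c: "c \<in> A" and
      K: "\<forall>S\<in>K. S \<subseteq> carrier A \<and> (\<forall>c\<in>A. open (snd c ` (S \<inter> fst c)))"
    have "snd c ` (\<Union>K \<inter> fst c) = (\<Union>S\<in>K. snd c ` (S \<inter> fst c))"
      by auto
    then show "open (snd c ` (\<Union>K \<inter> fst c))"
      using K c by auto
  qed auto
  then show ?thesis
    by (simp add: atlas_topology_def topology_inverse')
qed

text \<open>
  The model space is an arbitrary vector space of dimension m, rather than a type of class
  \<open>euclidean_space\<close>, because the latter class excludes dimension 0. Such a space is automatically complete, hence
  the class \<open>banach\<close> imposes no restriction on it.
\<close>

definition smooth_manifold :: "nat \<Rightarrow> ('a, 'e::real_normed_vector) atlas \<Rightarrow> bool" where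
  "smooth_manifold m A \<longleftrightarrow>
     (\<exists>B :: 'e set. independent B \<and> span B = UNIV \<and> finite B \<and> card B = m) \<and>
     smooth_atlas A \<and> Hausdorff_space (atlas_topology A) \<and> second_countable (atlas_topology A)"

text \<open>The standard structure of a normed space, used for the real line.\<close>

definition model_atlas :: "('e, 'e) atlas" where
  "model_atlas = {(UNIV, id)}"

text \<open>
  Smoothness on an open subset S. The openness of the coordinate domain
  yields continuity of f.
\<close>

definition smooth_map_on ::
  "('a, 'e::real_normed_vector) atlas \<Rightarrow> ('b, 'f::real_normed_vector) atlas \<Rightarrow>
     'a set \<Rightarrow> ('a \<Rightarrow> 'b) \<Rightarrow> bool" where
  "smooth_map_on A B S f \<longleftrightarrow>
     (\<forall>p\<in>S. \<exists>c\<in>charts_at A p. \<exists>d\<in>charts_at B (f p).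
        open (snd c ` (S \<inter> fst c \<inter> f -` fst d)) \<and>
        smooth_on (snd c ` (S \<inter> fst c \<inter> f -` fst d)) (snd d \<circ> f \<circ> chart_inv c))"


section \<open>Tangent bundle and tangent maps\<close>

text \<open>
  A tangent vector at p is a family of vectors of the model space, one for each chart of the atlas
  at p, which transforms by the derivatives of the transition maps. The family is normalised to 0
  on everything that is not a chart at p, so that equality of tangent vectors is equality in HOL.
\<close>

type_synonym ('a, 'e) tangent = "'a \<times> (('a, 'e) chart \<Rightarrow> 'e)"

definition tangent_space ::
  "('a, 'e::real_normed_vector) atlas \<Rightarrow> 'a \<Rightarrow> ('a, 'e) tangent set" where
  "tangent_space A p =
     {w. p \<in> carrier A \<and> fst w = p \<and>
         (\<forall>c\<in>charts_at A p. \<forall>d\<in>charts_at A p.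
            snd w d = frechet_derivative (transition c d) (at (snd c p)) (snd w c)) \<and>
         (\<forall>c. c \<notin> charts_at A p \<longrightarrow> snd w c = 0)}"

definition tangent_bundle ::
  "('a, 'e::real_normed_vector) atlas \<Rightarrow> ('a, 'e) tangent set" where
  "tangent_bundle A = (\<Union>p\<in>carrier A. tangent_space A p)"

text \<open>
  The natural charts (q, v) make the tangent bundle a manifold modelled on \<open>'e \<times> 'e\<close>;
  the bundle projection is \<open>fst\<close>.
\<close>

definition tangent_chart ::
  "('a, 'e::real_normed_vector) atlas \<Rightarrow> ('a, 'e) chart \<Rightarrow> (('a, 'e) tangent, 'e \<times> 'e) chart" where
  "tangent_chart A c =
     ({w \<in> tangent_bundle A. fst w \<in> fst c}, \<lambda>w. (snd c (fst w), snd w c))"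

definition tangent_atlas ::
  "('a, 'e::real_normed_vector) atlas \<Rightarrow> (('a, 'e) tangent, 'e \<times> 'e) atlas" where
  "tangent_atlas A = tangent_chart A ` A"

text \<open>
  The tangent map of f. By the chain rule its value on a tangent vector
  does not depend on the chosen chart c.
\<close>

definition tangent_map ::
  "('a, 'e::real_normed_vector) atlas \<Rightarrow> ('b, 'f::real_normed_vector) atlas \<Rightarrow>
     ('a \<Rightarrow> 'b) \<Rightarrow> ('a, 'e) tangent \<Rightarrow> ('b, 'f) tangent" where
  "tangent_map A B f w =
     (f (fst w),
      \<lambda>d. if d \<in> charts_at B (f (fst w))
          then let c = (SOME c. c \<in> charts_at A (fst w))
               in frechet_derivative (snd d \<circ> f \<circ> chart_inv c) (at (snd c (fst w))) (snd w c)
          else 0)"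


section \<open>Vector fields and constants of the motion\<close>

definition vector_field_on ::
  "('a, 'e::real_normed_vector) atlas \<Rightarrow> 'a set \<Rightarrow> ('a \<Rightarrow> ('a, 'e) tangent) \<Rightarrow> bool" where
  "vector_field_on N W Z \<longleftrightarrow>
     openin (atlas_topology N) W \<and> (\<forall>p\<in>W. Z p \<in> tangent_space N p) \<and>
     smooth_map_on N (tangent_atlas N) W Z"

definition local_vector_field ::
  "('a, 'e::real_normed_vector) atlas \<Rightarrow> 'a set \<Rightarrow> 'a \<Rightarrow> 'a set \<Rightarrow>
     ('a \<Rightarrow> ('a, 'e) tangent) \<Rightarrow> bool" where
  "local_vector_field N P p W Z \<longleftrightarrow> p \<in> W \<and> W \<subseteq> P \<and> vector_field_on N W Z"

definition velocity ::
  "('a, 'e::real_normed_vector) atlas \<Rightarrow> (real \<Rightarrow> 'a) \<Rightarrow> real \<Rightarrow> ('a, 'e) tangent" where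
  "velocity N \<gamma> t =
     (\<gamma> t, \<lambda>d. if d \<in> charts_at N (\<gamma> t) then vector_derivative (snd d \<circ> \<gamma>) (at t) else 0)"

definition integral_curve ::
  "('a, 'e::real_normed_vector) atlas \<Rightarrow> 'a set \<Rightarrow> ('a \<Rightarrow> ('a, 'e) tangent) \<Rightarrow>
     real set \<Rightarrow> (real \<Rightarrow> 'a) \<Rightarrow> bool" where
  "integral_curve N W Z I \<gamma> \<longleftrightarrow>
     open I \<and> is_interval I \<and> \<gamma> ` I \<subseteq> W \<and> smooth_map_on model_atlas N I \<gamma> \<and>
     (\<forall>t\<in>I. velocity N \<gamma> t = Z (\<gamma> t))"

definition constant_of_motion ::
  "('a, 'e::real_normed_vector) atlas \<Rightarrow> 'a set \<Rightarrow> ('a \<Rightarrow> ('a, 'e) tangent) \<Rightarrow>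
     ('a \<Rightarrow> real) \<Rightarrow> bool" where
  "constant_of_motion N W Z f \<longleftrightarrow>
     (\<forall>I \<gamma>. integral_curve N W Z I \<gamma> \<longrightarrow> (f \<circ> \<gamma>) constant_on I)"

text \<open>Here Z is a vector field on an open subset W of the tangent bundle of the manifold A.\<close>

definition second_order ::
  "('a, 'e::real_normed_vector) atlas \<Rightarrow> ('a, 'e) tangent set \<Rightarrow>
     (('a, 'e) tangent \<Rightarrow> (('a, 'e) tangent, 'e \<times> 'e) tangent) \<Rightarrow> bool" where
  "second_order A W Z \<longleftrightarrow> (\<forall>w\<in>W. tangent_map (tangent_atlas A) A fst (Z w) = w)"


section \<open>Fibre derivative\<close>

text \<open>
  The covector \<open>fibre_derivative A f w\<close> is a function on the tangent space containing w. Its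
  value on u is the differential at w of the restriction of f to this vector space, applied to
  u, that is, the derivative of f(w + t u) with respect to t at 0.
\<close>

definition fibre_derivative ::
  "('a, 'e::real_normed_vector) atlas \<Rightarrow> (('a, 'e) tangent \<Rightarrow> real) \<Rightarrow>
     ('a, 'e) tangent \<Rightarrow> ('a, 'e) tangent \<Rightarrow> real" where
  "fibre_derivative A f w =
     (\<lambda>u\<in>tangent_space A (fst w). deriv (\<lambda>t. f (fst w, \<lambda>c. snd w c + t *\<^sub>R snd u c)) 0)"

definition independent_covectors ::
  "('a, 'e::real_normed_vector) atlas \<Rightarrow> 'a \<Rightarrow> 'i set \<Rightarrow> ('i \<Rightarrow> ('a, 'e) tangent \<Rightarrow> real) \<Rightarrow> bool" where
  "independent_covectors A p J \<alpha> \<longleftrightarrow>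
     (\<forall>a :: 'i \<Rightarrow> real. (\<forall>u\<in>tangent_space A p. (\<Sum>i\<in>J. a i * \<alpha> i u) = 0) \<longrightarrow> (\<forall>i\<in>J. a i = 0))"

end

(*
In natural coordinates a second-order field is Z = (v, a(q, v)), and f^i is constant along its
integral curves iff D f^i (v, 0) + D f^i (0, a) = 0, the covectors u |-> D f^i (0, u) being the
fibre derivatives. These m independent conditions on a vector of an m-dimensional space have a
unique solution. It depends smoothly on the point: a Gram-Schmidt process produces a smooth frame
dual to the fibre derivatives, and a is a combination of this frame. Constants of the motion are
defined through integral curves, so uniqueness also requires that an integral curve of a smooth
field passes through every point (Picard-Lindeloef).
*)
theory Submission
  imports Defs
begin

section \<open>Iterated directional derivatives\<close>

text \<open>The model space is a finite-dimensional normed space with no chosen basis or inner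
  product. \<open>Ck_on\<close> only sees derivatives in constant directions, whereas the chain
  rule, the transition maps (q, v) |-> (t(q), Dt(q) v) of the tangent bundle and the functions D f^i
  (v, 0) all differentiate in a direction that moves with the point. A basis with continuous
  coordinate functionals bridges this gap, and this is why finite dimension enters every
  composition.

  The tangent bundle is treated as a manifold in its own right, modelled on pairs: results on vector
  fields are proved for a general atlas and then applied to the natural charts. A tangent vector is
  a whole family of coordinates, but one chart determines it, so fields are built and compared in a
  single natural chart.

  The dual frame serves twice. It gives a formula for the accelerations a, and its existence at
  every point of a neighbourhood of v makes the linear system nonsingular there, so that uniqueness
  holds point by point on the common domain.\<close>

lemma frechet_eqI: "(f has_derivative f') (at x) \<Longrightarrow> frechet_derivative f (at x) = f'"
  using frechet_derivative_at by metis

lemma frechet_derivative_works': "f differentiable (at x) \<Longrightarrow> (f has_derivative frechet_derivative f (at x)) (at x)"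
  by (simp add: frechet_derivative_works)

text \<open>A derivative at x depends on values in a full neighbourhood of x, so openness of S lets
  equality on S pass to all derivatives.\<close>

lemma Ck_on_cong_imp:
  assumes "open S" "\<And>x. x \<in> S \<Longrightarrow> f x = g x" "Ck_on k S f"
  shows "Ck_on k S g"
  using assms(2,3)
proof (induction k arbitrary: f g)
  case 0
  then show ?case using continuous_on_cong by (metis Ck_on.simps(1))
next
  case (Suc k)
  have *: "(g has_derivative frechet_derivative f (at x)) (at x)" if "x \<in> S" for x
  proof (rule has_derivative_transform_within_open[OF _ \<open>open S\<close> that])
    show "(f has_derivative frechet_derivative f (at x)) (at x)"
      using Suc.prems(2) that frechet_derivative_works by auto
  qed (use Suc.prems in auto)
  have "Ck_on k S (\<lambda>x. frechet_derivative g (at x) h)" for h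
  proof (rule Suc.IH)
    show "Ck_on k S (\<lambda>x. frechet_derivative f (at x) h)" using Suc.prems by auto
    show "frechet_derivative f (at x) h = frechet_derivative g (at x) h" if "x \<in> S" for x
      using frechet_eqI[OF *[OF that]] by simp
  qed
  with * show ?case by (auto simp: differentiable_def)
qed

lemma Ck_on_SucI:
  assumes "open S" "\<And>x. x \<in> S \<Longrightarrow> (f has_derivative f' x) (at x)"
    "\<And>h. Ck_on k S (\<lambda>x. f' x h)"
  shows "Ck_on (Suc k) S f"
proof -
  have "Ck_on k S (\<lambda>x. frechet_derivative f (at x) h)" for h
    by (rule Ck_on_cong_imp[OF assms(1) _ assms(3)[of h]]) (simp add: frechet_eqI[OF assms(2)])
  then show ?thesis using assms(2) by (auto simp: differentiable_def)
qed

lemma Ck_on_SucD: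
  assumes "Ck_on (Suc k) S f"
  shows "x \<in> S \<Longrightarrow> (f has_derivative frechet_derivative f (at x)) (at x)"
    "Ck_on k S (\<lambda>x. frechet_derivative f (at x) h)"
  using assms frechet_derivative_works by auto

lemma Ck_on_Suc_imp: "Ck_on (Suc k) S f \<Longrightarrow> Ck_on k S f"
proof (induction k arbitrary: f)
  case 0
  then show ?case
    by (auto intro!: continuous_at_imp_continuous_on differentiable_imp_continuous_within)
next
  case (Suc k)
  then show ?case using Ck_on.simps(2) by blast
qed

lemma Ck_on_continuous: "Ck_on k S f \<Longrightarrow> continuous_on S f"
  by (induction k) (use Ck_on_Suc_imp in auto)

lemma Ck_on_subset: "Ck_on k S f \<Longrightarrow> T \<subseteq> S \<Longrightarrow> Ck_on k T f"
  by (induction k arbitrary: f) (auto intro: continuous_on_subset)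

lemma Ck_on_local:
  assumes "\<And>x. x \<in> S \<Longrightarrow> \<exists>T. open T \<and> x \<in> T \<and> Ck_on k T f"
  shows "Ck_on k S f"
  using assms
proof (induction k arbitrary: f)
  case 0
  then show ?case
    unfolding Ck_on.simps by (intro continuous_at_imp_continuous_on) (metis continuous_on_eq_continuous_at)
next
  case (Suc k)
  have "f differentiable (at x)" if "x \<in> S" for x
    using Suc.prems[OF that] by auto
  moreover have "Ck_on k S (\<lambda>x. frechet_derivative f (at x) h)" for h
    by (rule Suc.IH) (use Suc.prems in fastforce)
  ultimately show ?case by auto
qed

section \<open>Closure of C^k under algebraic operations\<close>

lemma Ck_on_const: "Ck_on k S (\<lambda>x. c)"
  by (induction k arbitrary: c) auto

lemma Ck_on_bounded_linear:
  assumes "open S" "Ck_on k S f" "bounded_linear L"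
  shows "Ck_on k S (\<lambda>x. L (f x))"
  using assms(2)
proof (induction k arbitrary: f)
  case 0
  then show ?case using assms(3) by (auto intro: bounded_linear.continuous_on)
next
  case (Suc k)
  show ?case
    by (rule Ck_on_SucI[OF assms(1) bounded_linear.has_derivative[OF assms(3) Ck_on_SucD(1)[OF Suc.prems]]])
      (use Suc in auto)
qed

lemma Ck_on_id: "Ck_on k S (\<lambda>x. x)"
proof (cases k)
  case (Suc j)
  then show ?thesis
    by (auto simp: frechet_eqI[OF has_derivative_ident] Ck_on_const)
qed auto

lemma Ck_on_linear:
  assumes "bounded_linear L" "open S"
  shows "Ck_on k S L"
  using Ck_on_bounded_linear[OF assms(2) Ck_on_id assms(1)] .

lemma Ck_on_add:
  assumes "open S" "Ck_on k S f" "Ck_on k S g"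
  shows "Ck_on k S (\<lambda>x. f x + g x)"
  using assms(2,3)
proof (induction k arbitrary: f g)
  case 0
  then show ?case by (auto intro: continuous_on_add)
next
  case (Suc k)
  show ?case
    by (rule Ck_on_SucI[OF assms(1) has_derivative_add[OF Ck_on_SucD(1)[OF Suc.prems(1)] Ck_on_SucD(1)[OF Suc.prems(2)]]])
      (use Suc in auto)
qed

lemma Ck_on_uminus:
  "open S \<Longrightarrow> Ck_on k S f \<Longrightarrow> Ck_on k S (\<lambda>x. - f x)"
  by (rule Ck_on_bounded_linear[where L=uminus]) (auto intro: bounded_linear_minus bounded_linear_ident)

lemma Ck_on_diff:
  "open S \<Longrightarrow> Ck_on k S f \<Longrightarrow> Ck_on k S g \<Longrightarrow> Ck_on k S (\<lambda>x. f x - g x)"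
  using Ck_on_add[of S k f "\<lambda>x. - g x"] Ck_on_uminus[of S k g] by auto

lemma Ck_on_sum:
  "open S \<Longrightarrow> (\<And>i. i \<in> J \<Longrightarrow> Ck_on k S (f i)) \<Longrightarrow> Ck_on k S (\<lambda>x. \<Sum>i\<in>J. f i x)"
  by (induction J rule: infinite_finite_induct) (auto intro: Ck_on_const Ck_on_add)

text \<open>By the product rule the derivative is a sum of two products of the same kind, which is
  why both factors are generalised in the induction.\<close>

lemma Ck_on_bilinear:
  assumes "bounded_bilinear p" "open S" "Ck_on k S f" "Ck_on k S g"
  shows "Ck_on k S (\<lambda>x. p (f x) (g x))"
  using assms(3,4)
proof (induction k arbitrary: f g)
  case 0
  then show ?case using assms(1) by (auto intro: bounded_bilinear.continuous_on)
next
  case (Suc k)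
  have "Ck_on k S f" "Ck_on k S g" using Suc.prems Ck_on_Suc_imp by blast+
  have "Ck_on k S (\<lambda>x. p (f x) (frechet_derivative g (at x) h) + p (frechet_derivative f (at x) h) (g x))" for h
    by (intro Ck_on_add[OF assms(2)] Suc.IH Ck_on_SucD(2) Suc.prems) fact+
  with Suc.prems show ?case
    by (intro Ck_on_SucI[OF assms(2) bounded_bilinear.FDERIV[OF assms(1) Ck_on_SucD(1)[OF Suc.prems(1)] Ck_on_SucD(1)[OF Suc.prems(2)]]])
qed

lemmas Ck_on_scaleR = Ck_on_bilinear[OF bounded_bilinear_scaleR]
lemmas Ck_on_mult = Ck_on_bilinear[OF bounded_bilinear_mult]

text \<open>The derivative is - (1/f) Df (1/f), in which 1/f itself is only required to be one class
  lower.\<close>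

lemma Ck_on_inverse:
  fixes f :: "'e::real_normed_vector \<Rightarrow> real"
  assumes "open S" "\<And>x. x \<in> S \<Longrightarrow> f x \<noteq> 0" "Ck_on k S f"
  shows "Ck_on k S (\<lambda>x. inverse (f x))"
  using assms(3)
proof (induction k)
  case 0
  then show ?case using assms(2) by (auto intro!: continuous_on_inverse)
next
  case (Suc k)
  have "Ck_on k S f" using Suc.prems Ck_on_Suc_imp by blast
  with Suc show ?case
    by (intro Ck_on_SucI[OF assms(1) Deriv.has_derivative_inverse[OF assms(2) Ck_on_SucD(1)[OF Suc.prems]]])
      (auto intro!: Ck_on_uminus Ck_on_mult assms(1))
qed

lemma Ck_on_Pair:
  assumes "open S" "Ck_on k S f" "Ck_on k S g"
  shows "Ck_on k S (\<lambda>x. (f x, g x))"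
  using assms(2,3)
proof (induction k arbitrary: f g)
  case 0
  then show ?case by (auto intro: continuous_on_Pair)
next
  case (Suc k)
  show ?case
    by (rule Ck_on_SucI[OF assms(1) has_derivative_Pair[OF Ck_on_SucD(1)[OF Suc.prems(1)] Ck_on_SucD(1)[OF Suc.prems(2)]]])
      (use Suc in auto)
qed

section \<open>Finite-dimensional normed spaces\<close>

text \<open>A predicate on the type rather than a type class, because the manifold hypothesis
  supplies its basis as a fact about \<open>'e\<close>, and dimension 0 must be allowed.\<close>

definition finite_dim :: "'e::real_vector itself \<Rightarrow> bool" where
  "finite_dim T \<longleftrightarrow> (\<exists>B :: 'e set. finite B \<and> span B = UNIV)"

text \<open>A Minkowski sum of finitely many compact segments. This is the source of compactness in
  a normed space not yet known to be locally compact.\<close>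

lemma compact_parallelotope:
  fixes B :: "'e::real_normed_vector set"
  assumes "finite B"
  shows "compact {\<Sum>b\<in>B. a b *\<^sub>R b | a. \<forall>b\<in>B. \<bar>a b\<bar> \<le> (1::real)}"
  using assms
proof (induction B rule: finite_induct)
  case empty
  then show ?case by simp
next
  case (insert b B)
  let ?K = "\<lambda>B. {\<Sum>b\<in>B. a b *\<^sub>R b | a. \<forall>b\<in>B. \<bar>a b\<bar> \<le> (1::real)}"
  have "compact ((\<lambda>t::real. t *\<^sub>R b) ` {-1..1})"
    by (intro compact_continuous_image continuous_intros) auto
  from compact_sums[OF this insert.IH]
  have "compact {x + y |x y. x \<in> (\<lambda>t::real. t *\<^sub>R b) ` {-1..1} \<and> y \<in> ?K B}" .
  also have "{x + y |x y. x \<in> (\<lambda>t::real. t *\<^sub>R b) ` {-1..1} \<and> y \<in> ?K B} = ?K (insert b B)"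
  proof (intro subset_antisym subsetI)
    fix z assume "z \<in> {x + y |x y. x \<in> (\<lambda>t::real. t *\<^sub>R b) ` {-1..1} \<and> y \<in> ?K B}"
    then obtain t a where z: "z = t *\<^sub>R b + (\<Sum>b\<in>B. a b *\<^sub>R b)" and "\<bar>t\<bar> \<le> 1" and "\<forall>b\<in>B. \<bar>a b\<bar> \<le> 1"
      by (auto simp: abs_le_iff)
    moreover have "(\<Sum>c\<in>B. (a(b := t)) c *\<^sub>R c) = (\<Sum>c\<in>B. a c *\<^sub>R c)"
      by (rule sum.cong) (use insert.hyps in auto)
    ultimately show "z \<in> ?K (insert b B)"
      using insert.hyps by (auto intro!: exI[of _ "a(b := t)"])
  next
    fix z assume "z \<in> ?K (insert b B)"
    then obtain a where "z = a b *\<^sub>R b + (\<Sum>b\<in>B. a b *\<^sub>R b)" "\<bar>a b\<bar> \<le> 1" "\<forall>b\<in>B. \<bar>a b\<bar> \<le> 1"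
      using insert.hyps by auto
    then show "z \<in> {x + y |x y. x \<in> (\<lambda>t::real. t *\<^sub>R b) ` {-1..1} \<and> y \<in> ?K B}"
      by (fastforce simp: abs_le_iff)
  qed
  finally show ?case .
qed

lemma independent_coordinates_bounded:
  fixes B :: "'e::real_normed_vector set"
  assumes "finite B" "independent B"
  obtains C where "\<And>a b. b \<in> B \<Longrightarrow> \<bar>a b\<bar> \<le> C * norm (\<Sum>b\<in>B. a b *\<^sub>R b)"
proof -
  (* By compactness the norm is bounded below on each face of the unit cube in coordinates. *)
  have face: "\<exists>\<delta>>0. \<forall>a. a c = 1 \<and> (\<forall>b\<in>B. \<bar>a b\<bar> \<le> 1) \<longrightarrow> \<delta> \<le> norm (\<Sum>b\<in>B. a b *\<^sub>R b)"
    if c: "c \<in> B" for c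
  proof -
    let ?K = "(+) c ` {\<Sum>b\<in>B - {c}. a b *\<^sub>R b | a. \<forall>b\<in>B - {c}. \<bar>a b\<bar> \<le> (1::real)}"
    have K: "compact ?K"
      using assms(1) by (intro compact_translation compact_parallelotope) auto
    have sum_eq: "(\<Sum>b\<in>B. a b *\<^sub>R b) = a c *\<^sub>R c + (\<Sum>b\<in>B - {c}. a b *\<^sub>R b)" for a :: "'e \<Rightarrow> real"
      using assms(1) c by (simp add: sum.remove)
    have "0 \<notin> ?K"
    proof
      assume "0 \<in> ?K"
      then obtain a where "0 = c + (\<Sum>b\<in>B - {c}. a b *\<^sub>R b)" by auto
      moreover have "(\<Sum>b\<in>B. (a(c := 1)) b *\<^sub>R b) = c + (\<Sum>b\<in>B - {c}. a b *\<^sub>R b)"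
        unfolding sum_eq by (auto intro!: sum.cong)
      ultimately have "(a(c := 1)) c = 0"
        using assms c independentD[OF assms(2,1) subset_refl, of "a(c := 1)" c] by auto
      then show False by simp
    qed
    then obtain \<delta> where "\<delta> > 0" and ball: "ball 0 \<delta> \<subseteq> - ?K"
      using open_contains_ball[of "- ?K"] open_Compl[OF compact_imp_closed[OF K]] by blast
    have \<delta>: "\<delta> \<le> dist 0 z" if "z \<in> ?K" for z
    proof (rule ccontr)
      assume "\<not> \<delta> \<le> dist 0 z"
      then have "z \<in> ball 0 \<delta>" by simp
      with ball that show False by blast
    qed
    show ?thesis
    proof (intro exI conjI allI impI)
      show "\<delta> > 0" by fact
      fix a :: "'e \<Rightarrow> real" assume a: "a c = 1 \<and> (\<forall>b\<in>B. \<bar>a b\<bar> \<le> 1)"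
      then have "(\<Sum>b\<in>B. a b *\<^sub>R b) \<in> ?K" unfolding sum_eq by auto
      from \<delta>[OF this] show "\<delta> \<le> norm (\<Sum>b\<in>B. a b *\<^sub>R b)" by simp
    qed
  qed
  then obtain \<delta> where \<delta>: "\<And>c. c \<in> B \<Longrightarrow> \<delta> c > 0"
    "\<And>c a. c \<in> B \<Longrightarrow> a c = 1 \<Longrightarrow> (\<forall>b\<in>B. \<bar>a b\<bar> \<le> 1) \<Longrightarrow> \<delta> c \<le> norm (\<Sum>b\<in>B. a b *\<^sub>R b)"
    by metis
  \<comment> \<open>A sum rather than a maximum, so that an empty B needs no special case.\<close>
  define C where "C = (\<Sum>c\<in>B. 1 / \<delta> c)"
  have "\<bar>a b\<bar> \<le> C * norm (\<Sum>b\<in>B. a b *\<^sub>R b)" if b: "b \<in> B" for a b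
  proof -
    \<comment> \<open>The coefficient of largest modulus is selected: dividing by it puts the vector
      on the face belonging to c.\<close>
    have "Max ((\<lambda>b. \<bar>a b\<bar>) ` B) \<in> (\<lambda>b. \<bar>a b\<bar>) ` B"
      using assms(1) b by (intro Max_in) auto
    then obtain c where c: "c \<in> B" "\<And>b. b \<in> B \<Longrightarrow> \<bar>a b\<bar> \<le> \<bar>a c\<bar>"
      using Max_ge[of "(\<lambda>b. \<bar>a b\<bar>) ` B"] assms(1) by fastforce
    have C: "1 / \<delta> c \<le> C"
      unfolding C_def using c(1) assms(1) \<delta>(1) by (intro member_le_sum) (auto simp: less_imp_le)
    show ?thesis
    proof (cases "a c = 0")
      case True
      then show ?thesis using c b C \<delta>(1)[OF c(1)]
        by (smt (verit) divide_pos_pos mult_nonneg_nonneg norm_ge_zero)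
    next
      case False
      have "\<delta> c \<le> norm (\<Sum>b\<in>B. (a b / a c) *\<^sub>R b)"
        by (rule \<delta>(2)) (use c False in \<open>auto simp: field_simps\<close>)
      also have "(\<Sum>b\<in>B. (a b / a c) *\<^sub>R b) = (1 / a c) *\<^sub>R (\<Sum>b\<in>B. a b *\<^sub>R b)"
        by (simp add: scaleR_sum_right)
      finally have "\<bar>a c\<bar> \<le> (1 / \<delta> c) * norm (\<Sum>b\<in>B. a b *\<^sub>R b)"
        using False \<delta>(1)[OF c(1)] by (simp add: field_simps)
      also have "\<dots> \<le> C * norm (\<Sum>b\<in>B. a b *\<^sub>R b)" using C by (intro mult_right_mono) auto
      finally show ?thesis using c(2)[OF b] by simp
    qed
  qed
  then show thesis using that by blast
qed

text \<open>The form in which finite dimension is used: a vector that varies with a point becomes a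
  finite sum of constant vectors with equally regular coefficients.\<close>

lemma finite_dim_coordinates:
  assumes "finite_dim TYPE('e)"
  obtains B :: "'e::real_normed_vector set" and \<kappa> where "finite B" "\<And>b. b \<in> B \<Longrightarrow> bounded_linear (\<kappa> b)"
    "\<And>x. x = (\<Sum>b\<in>B. \<kappa> b x *\<^sub>R b)"
proof -
  obtain B0 :: "'e set" where B0: "finite B0" "span B0 = UNIV" using assms unfolding finite_dim_def by auto
  obtain B where B: "B \<subseteq> B0" "independent B" "B0 \<subseteq> span B"
    using maximal_independent_subset by blast
  have fB: "finite B" using B B0 finite_subset by blast
  have sB: "span B = UNIV" using B B0 span_minimal[OF B(3)] by auto
  define \<kappa> where "\<kappa> b x = representation B x b" for b x
  have rep: "(\<Sum>b\<in>B. \<kappa> b x *\<^sub>R b) = x" for x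
    unfolding \<kappa>_def using B(2) fB sB by (intro real_vector.sum_representation_eq) auto
  obtain C where C: "\<And>a b. b \<in> B \<Longrightarrow> \<bar>a b\<bar> \<le> C * norm (\<Sum>b\<in>B. a b *\<^sub>R b)"
    using independent_coordinates_bounded[OF fB B(2)] by blast
  have "bounded_linear (\<kappa> b)" if "b \<in> B" for b
  proof (rule bounded_linear_intro[where K=C])
    show "\<kappa> b (x + y) = \<kappa> b x + \<kappa> b y" for x y
      unfolding \<kappa>_def using B(2) sB by (simp add: representation_add)
    show "\<kappa> b (r *\<^sub>R x) = r *\<^sub>R \<kappa> b x" for r x
      unfolding \<kappa>_def using B(2) sB by (simp add: representation_scale)
    show "norm (\<kappa> b x) \<le> norm x * C" for x
      using C[OF that, of "\<lambda>b. \<kappa> b x"] by (simp add: rep mult.commute)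
  qed
  then show thesis using that[OF fB _ rep[symmetric]] by blast
qed

text \<open>Pairs are the model space of the tangent bundle, to which the results for
  finite-dimensional model spaces must apply again.\<close>

lemma finite_dim_prod:
  assumes "finite_dim TYPE('e)" "finite_dim TYPE('f)"
  shows "finite_dim TYPE('e::real_vector \<times> 'f::real_vector)"
proof -
  obtain B :: "'e set" where B: "finite B" "span B = UNIV" using assms unfolding finite_dim_def by auto
  obtain C :: "'f set" where C: "finite C" "span C = UNIV" using assms unfolding finite_dim_def by auto
  let ?D = "(\<lambda>x. (x, 0)) ` B \<union> (\<lambda>x. (0, x)) ` C"
  have "(x, y) \<in> span ?D" for x y
  proof -
    have "linear (\<lambda>x::'e. (x, 0::'f))" "linear (\<lambda>x::'f. (0::'e, x))"
      by (auto intro!: linearI)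
    then have "span ((\<lambda>x::'e. (x, 0::'f)) ` B) = (\<lambda>x. (x, 0)) ` UNIV"
      and "span ((\<lambda>x::'f. (0::'e, x)) ` C) = (\<lambda>x. (0, x)) ` UNIV"
      using B C by (simp_all add: linear_span_image)
    then have "(x, 0) \<in> span ((\<lambda>x::'e. (x, 0::'f)) ` B)"
      and "(0, y) \<in> span ((\<lambda>x::'f. (0::'e, x)) ` C)"
      by simp_all
    then have "(x, 0) \<in> span ?D" "(0, y) \<in> span ?D"
      by (meson span_mono subsetD Un_upper1 Un_upper2)+
    from span_add[OF this] show ?thesis by simp
  qed
  then show ?thesis unfolding finite_dim_def using B C
    by (intro exI[of _ ?D]) auto
qed

text \<open>Expanding the moving direction \<open>w x\<close> in a basis leaves a finite sum of
  products, each with a derivative in a constant direction. Assumption \<open>D\<close> is kept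
  separate because \<open>Ck_on_compose\<close> obtains it from its induction hypothesis.\<close>

lemma Ck_on_frechet_apply:
  fixes F :: "'e::real_normed_vector \<Rightarrow> 'f::real_normed_vector"
  assumes "finite_dim TYPE('e)" "open S" "Ck_on (Suc k) T F" "Ck_on k S w"
    and "\<And>x. x \<in> S \<Longrightarrow> g x \<in> T" and D: "\<And>h. Ck_on k S (\<lambda>x. frechet_derivative F (at (g x)) h)"
  shows "Ck_on k S (\<lambda>x. frechet_derivative F (at (g x)) (w x))"
proof -
  obtain B :: "'e set" and \<kappa> where B: "finite B" "\<And>b. b \<in> B \<Longrightarrow> bounded_linear (\<kappa> b)"
    "\<And>x. x = (\<Sum>b\<in>B. \<kappa> b x *\<^sub>R b)" using finite_dim_coordinates[OF assms(1)] by metis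
  have "Ck_on k S (\<lambda>x. \<Sum>b\<in>B. \<kappa> b (w x) *\<^sub>R frechet_derivative F (at (g x)) b)"
    by (intro Ck_on_sum Ck_on_scaleR D assms Ck_on_bounded_linear[OF assms(2,4) B(2)])
  then show ?thesis
  proof (rule Ck_on_cong_imp[OF assms(2), rotated])
    fix x assume "x \<in> S"
    then interpret linear "frechet_derivative F (at (g x))"
      using assms by (auto intro: linear_frechet_derivative)
    show "(\<Sum>b\<in>B. \<kappa> b (w x) *\<^sub>R frechet_derivative F (at (g x)) b) = frechet_derivative F (at (g x)) (w x)"
      by (subst (2) B(3)[of "w x"]) (simp add: sum scale)
  qed
qed

text \<open>The chain rule composes the derivatives of g with the same f, so the induction
  generalises g alone.\<close>

lemma Ck_on_compose:
  fixes f :: "'d::real_normed_vector \<Rightarrow> 'e::real_normed_vector"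
  assumes "finite_dim TYPE('e)" "open S" "Ck_on k S f" "Ck_on k T g" "\<And>x. x \<in> S \<Longrightarrow> f x \<in> T"
  shows "Ck_on k S (\<lambda>x. g (f x))"
  using assms(3,4)
proof (induction k arbitrary: g)
  case 0
  then show ?case using assms(5) continuous_on_compose2[of T g S f] by auto
next
  case (Suc k)
  have "Ck_on k S f" using Suc.prems Ck_on_Suc_imp by blast
  show ?case
  proof (rule Ck_on_SucI[OF assms(2)])
    show "((\<lambda>x. g (f x)) has_derivative
        (\<lambda>h. frechet_derivative g (at (f x)) (frechet_derivative f (at x) h))) (at x)" if "x \<in> S" for x
      using has_derivative_compose[OF Ck_on_SucD(1)[OF Suc.prems(1) that] Ck_on_SucD(1)[OF Suc.prems(2) assms(5)[OF that]]] .
    show "Ck_on k S (\<lambda>x. frechet_derivative g (at (f x)) (frechet_derivative f (at x) h))" for h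
      by (rule Ck_on_frechet_apply[OF assms(1,2) Suc.prems(2) Ck_on_SucD(2)[OF Suc.prems(1)] assms(5)])
        (assumption, rule Suc.IH[OF \<open>Ck_on k S f\<close> Ck_on_SucD(2)[OF Suc.prems(2)]])
  qed
qed

section \<open>Ordinary differential equations\<close>

text \<open>Near x0 the finitely many derivatives along a basis are bounded by continuity. This
  bounds the operator norm of the derivative, and the mean value inequality on a convex ball does
  the rest.\<close>

lemma C1_locally_Lipschitz:
  fixes X :: "'e::real_normed_vector \<Rightarrow> 'f::real_normed_vector"
  assumes fd: "finite_dim TYPE('e)" and U: "open U" "x0 \<in> U" and X: "Ck_on (Suc 0) U X"
  obtains r L where "r > 0" "L \<ge> 0" "cball x0 r \<subseteq> U"
    "\<And>x y. x \<in> cball x0 r \<Longrightarrow> y \<in> cball x0 r \<Longrightarrow> norm (X x - X y) \<le> L * norm (x - y)"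
proof -
  obtain B :: "'e set" and \<kappa> where B: "finite B" "\<And>b. b \<in> B \<Longrightarrow> bounded_linear (\<kappa> b)"
    "\<And>x. x = (\<Sum>b\<in>B. \<kappa> b x *\<^sub>R b)" using finite_dim_coordinates[OF fd] by metis
  let ?D = "\<lambda>x. frechet_derivative X (at x)"
  have "\<exists>K\<ge>0. \<forall>x. norm (\<kappa> b x) \<le> norm x * K" if "b \<in> B" for b
    using bounded_linear.nonneg_bounded[OF B(2)[OF that]] by auto
  then obtain K where K: "\<And>b. b \<in> B \<Longrightarrow> K b \<ge> 0" "\<And>b x. b \<in> B \<Longrightarrow> norm (\<kappa> b x) \<le> norm x * K b"
    by metis
  have "eventually (\<lambda>x. norm (?D x b) < norm (?D x0 b) + 1) (nhds x0)" for b
  proof -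
    have "isCont (\<lambda>x. norm (?D x b)) x0"
      using X U by (auto simp: continuous_on_eq_continuous_at intro: continuous_norm)
    then have "eventually (\<lambda>x. norm (?D x b) < norm (?D x0 b) + 1) (at x0)"
      unfolding isCont_def by (rule order_tendstoD) simp
    then show ?thesis by (simp add: eventually_nhds_conv_at)
  qed
  then have "eventually (\<lambda>x. x \<in> U \<and> (\<forall>b\<in>B. norm (?D x b) < norm (?D x0 b) + 1)) (nhds x0)"
    using eventually_nhds_in_open[OF U] B(1) by (intro eventually_conj eventually_ball_finite) auto
  then obtain d where d: "d > 0"
    "\<And>x. dist x x0 < d \<Longrightarrow> x \<in> U \<and> (\<forall>b\<in>B. norm (?D x b) < norm (?D x0 b) + 1)"
    unfolding eventually_nhds_metric by auto
  \<comment> \<open>With h expanded in the basis, \<open>K b\<close> controls its b-coordinate and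
    the other factor the derivative along b.\<close>
  define L where "L = (\<Sum>b\<in>B. K b * (norm (?D x0 b) + 1))"
  have sub: "cball x0 (d/2) \<subseteq> {x. dist x x0 < d}" using d(1) by (auto simp: dist_commute)
  have L: "norm (?D x h) \<le> L * norm h" if "x \<in> cball x0 (d/2)" for x h
  proof -
    have x: "x \<in> U" "\<And>b. b \<in> B \<Longrightarrow> norm (?D x b) \<le> norm (?D x0 b) + 1"
      using d(2)[of x] sub that by (auto simp: less_imp_le)
    interpret linear "?D x" using X x(1) by (auto intro: linear_frechet_derivative)
    have "norm (?D x h) = norm (\<Sum>b\<in>B. \<kappa> b h *\<^sub>R ?D x b)"
      by (subst B(3)[of h]) (simp add: sum scale)
    also have "\<dots> \<le> (\<Sum>b\<in>B. (norm h * K b) * (norm (?D x0 b) + 1))"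
    proof (rule order_trans[OF norm_sum sum_mono])
      fix b assume b: "b \<in> B"
      show "norm (\<kappa> b h *\<^sub>R ?D x b) \<le> (norm h * K b) * (norm (?D x0 b) + 1)"
        unfolding norm_scaleR using K(1)[OF b] K(2)[OF b, of h] x(2)[OF b]
        by (intro mult_mono) auto
    qed
    also have "\<dots> = L * norm h" unfolding L_def sum_distrib_right by (simp add: mult_ac)
    finally show ?thesis .
  qed
  have "L \<ge> 0" unfolding L_def using K(1) by (intro sum_nonneg mult_nonneg_nonneg) auto
  show thesis
  proof
    show "d/2 > 0" using d by simp
    show "L \<ge> 0" by fact
    show cb: "cball x0 (d/2) \<subseteq> U" using d sub by auto
    show "norm (X x - X y) \<le> L * norm (x - y)" if "x \<in> cball x0 (d/2)" "y \<in> cball x0 (d/2)" for x y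
    proof (rule differentiable_bound[OF convex_cball _ _ that])
      fix z assume z: "z \<in> cball x0 (d/2)"
      show "(X has_derivative ?D z) (at z within cball x0 (d/2))"
        by (rule has_derivative_at_withinI, rule Ck_on_SucD(1)[OF X]) (use cb z in blast)
      show "onorm (?D z) \<le> L" using \<open>L \<ge> 0\<close> L[OF z] by (rule onorm_bound)
    qed
  qed
qed

text \<open>The solution is the fixed point of the integral operator on continuous functions with
  values in a closed ball on which X is Lipschitz.\<close>

lemma Picard_Lindelof:
  fixes X :: "'e::banach \<Rightarrow> 'e"
  assumes fd: "finite_dim TYPE('e)" and U: "open U" "x0 \<in> U" and X: "Ck_on (Suc 0) U X"
  obtains \<epsilon> y where "\<epsilon> > 0" "y 0 = x0"
    "\<And>t. t \<in> {-\<epsilon><..<\<epsilon>} \<Longrightarrow> y t \<in> U"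
    "\<And>t. t \<in> {-\<epsilon><..<\<epsilon>} \<Longrightarrow> (y has_vector_derivative X (y t)) (at t)"
proof -
  obtain r L where rL: "r > 0" "L \<ge> 0" "cball x0 r \<subseteq> U"
    "\<And>x y. x \<in> cball x0 r \<Longrightarrow> y \<in> cball x0 r \<Longrightarrow> norm (X x - X y) \<le> L * norm (x - y)"
    using C1_locally_Lipschitz[OF fd U X] by metis
  \<comment> \<open>The Lipschitz estimate bounds the speed on the ball by its value at the centre
    plus L r.\<close>
  define M where "M = norm (X x0) + L * r"
  have M: "norm (X x) \<le> M" if "x \<in> cball x0 r" for x
  proof -
    have "norm (X x - X x0) \<le> L * norm (x - x0)" using rL that by auto
    also have "\<dots> \<le> L * r" using that rL by (intro mult_left_mono) (auto simp: dist_norm norm_minus_commute)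
    finally show ?thesis using norm_triangle_sub[of "X x" "X x0"] unfolding M_def by simp
  qed
  have M0: "M \<ge> 0" unfolding M_def using rL by auto
  \<comment> \<open>The first bound makes the integral operator a contraction with factor 1/2, the
    second keeps its values within distance r of x0. Adding 1 keeps the denominators positive when L
    or M vanishes.\<close>
  define \<epsilon> where "\<epsilon> = min (1 / (6 * (L + 1))) (r / (3 * (M + 1)))"
  have \<epsilon>: "\<epsilon> > 0" using rL M0 by (simp add: \<epsilon>_def)
  have "3 * \<epsilon> * L \<le> 3 * (1 / (6 * (L + 1))) * L" unfolding \<epsilon>_def using rL by (intro mult_right_mono mult_left_mono) auto
  also have "\<dots> \<le> 1/2" using rL by (simp add: field_simps)
  finally have \<epsilon>L: "3 * \<epsilon> * L \<le> 1/2" .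
  have "3 * \<epsilon> * M \<le> 3 * (r / (3 * (M + 1))) * M" unfolding \<epsilon>_def using M0 by (intro mult_right_mono mult_left_mono) auto
  also have "\<dots> \<le> r" using rL M0 by (simp add: field_simps)
  finally have \<epsilon>M: "3 * \<epsilon> * M \<le> r" .
  define c where "c t = max (-\<epsilon>) (min \<epsilon> t)" for t
  have c: "c t \<in> {-\<epsilon>..\<epsilon>}" for t using \<epsilon> by (auto simp: c_def)
  have c_cont: "continuous_on UNIV c" unfolding c_def by (intro continuous_intros)
  define J where "J \<phi> t = integral {-\<epsilon>..t} (\<lambda>s. X (apply_bcontfun \<phi> s))" for \<phi> t
  define S where "S = PiC (UNIV::real set) (\<lambda>_. cball x0 r)"
  have S: "\<phi> \<in> S \<longleftrightarrow> (\<forall>t. apply_bcontfun \<phi> t \<in> cball x0 r)" for \<phi>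
    by (auto simp: S_def mem_PiC_iff)
  have contX: "continuous_on T (\<lambda>s. X (apply_bcontfun \<phi> s))" if "\<phi> \<in> S" for \<phi> T
    using Ck_on_continuous[OF X] that rL(3) by (auto simp: S intro!: continuous_on_compose2[of U X])
  have J_bound: "norm (J \<phi> t) \<le> M * (t + \<epsilon>)" if "\<phi> \<in> S" "t \<in> {-\<epsilon>..\<epsilon>}" for \<phi> t
    using integral_bound[OF _ contX[OF that(1)], of "-\<epsilon>" t M] that M by (auto simp: J_def S)
  have J_lip: "norm (J \<phi> t - J \<psi> t) \<le> (L * dist \<phi> \<psi>) * (t + \<epsilon>)" if "\<phi> \<in> S" "\<psi> \<in> S" "t \<in> {-\<epsilon>..\<epsilon>}" for \<phi> \<psi> t
  proof -
    have "J \<phi> t - J \<psi> t = integral {-\<epsilon>..t} (\<lambda>s. X (apply_bcontfun \<phi> s) - X (apply_bcontfun \<psi> s))"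
      unfolding J_def using that contX
      by (intro integral_diff[symmetric] integrable_continuous_interval) auto
    moreover have "norm (X (apply_bcontfun \<phi> s) - X (apply_bcontfun \<psi> s)) \<le> L * dist \<phi> \<psi>" for s
    proof -
      have "norm (X (apply_bcontfun \<phi> s) - X (apply_bcontfun \<psi> s)) \<le> L * norm (apply_bcontfun \<phi> s - apply_bcontfun \<psi> s)"
        using rL(4) that by (auto simp: S)
      also have "\<dots> \<le> L * dist \<phi> \<psi>"
        using dist_bounded[of \<phi> s \<psi>] rL(2) by (intro mult_left_mono) (auto simp: dist_norm)
      finally show ?thesis .
    qed
    moreover have "continuous_on {-\<epsilon>..t} (\<lambda>s. X (apply_bcontfun \<phi> s) - X (apply_bcontfun \<psi> s))"
      using that by (intro continuous_on_diff contX)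
    ultimately show ?thesis
      using integral_bound[of "-\<epsilon>" t "\<lambda>s. X (apply_bcontfun \<phi> s) - X (apply_bcontfun \<psi> s)" "L * dist \<phi> \<psi>"] that
      by simp
  qed
  (* Integrating from -\<epsilon> and subtracting the value at 0 avoids integrals over reversed intervals;
     the price is the factor 3 in the choice of \<epsilon>. *)
  define T where "T \<phi> = Bcontfun (\<lambda>t. x0 + (J \<phi> (c t) - J \<phi> 0))" for \<phi>
  have zero: "0 \<in> {-\<epsilon>..\<epsilon>}" using \<epsilon> by auto
  have J_close: "norm (J \<phi> (c t) - J \<phi> 0) \<le> r" if "\<phi> \<in> S" for \<phi> t
  proof -
    have "norm (J \<phi> (c t) - J \<phi> 0) \<le> M * (c t + \<epsilon>) + M * (0 + \<epsilon>)"
      using J_bound[OF that c[of t]] J_bound[OF that zero] norm_triangle_ineq4[of "J \<phi> (c t)" "J \<phi> 0"] by linarith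
    also have "\<dots> \<le> M * (\<epsilon> + \<epsilon>) + M * (0 + \<epsilon>)" using M0 c[of t] by (intro add_mono mult_left_mono) auto
    also have "\<dots> = 3 * \<epsilon> * M" by (simp add: algebra_simps)
    finally show ?thesis using \<epsilon>M by simp
  qed
  have T: "apply_bcontfun (T \<phi>) = (\<lambda>t. x0 + (J \<phi> (c t) - J \<phi> 0))" if "\<phi> \<in> S" for \<phi>
  proof -
    have "continuous_on {-\<epsilon>..\<epsilon>} (J \<phi>)"
      unfolding J_def using contX[OF that]
      by (intro indefinite_integral_continuous_1 integrable_continuous_interval) auto
    then have "continuous_on UNIV (\<lambda>t. J \<phi> (c t))"
      using c by (intro continuous_on_compose2[OF _ c_cont]) auto
    moreover have "norm (x0 + (J \<phi> (c t) - J \<phi> 0)) \<le> norm x0 + r" for t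
      using J_close[OF that, of t] norm_triangle_ineq[of x0 "J \<phi> (c t) - J \<phi> 0"] by linarith
    ultimately have "(\<lambda>t. x0 + (J \<phi> (c t) - J \<phi> 0)) \<in> bcontfun"
      by (intro bcontfun_normI[where b="norm x0 + r"] continuous_intros) auto
    then show ?thesis unfolding T_def by (rule Bcontfun_inverse)
  qed
  have "\<exists>!\<phi>\<in>S. T \<phi> = \<phi>"
  proof (rule Banach_fix[where c="1/2"])
    show "complete S" unfolding S_def by (auto simp: complete_eq_closed intro: closed_PiC)
    have "const_bcontfun x0 \<in> S" using rL(1) by (auto simp: S const_bcontfun.rep_eq)
    then show "S \<noteq> {}" by auto
    show "T ` S \<subseteq> S"
    proof (intro image_subsetI)
      fix \<phi> assume "\<phi> \<in> S"
      then show "T \<phi> \<in> S" using J_close[of \<phi>] by (simp add: S[of "T \<phi>"] T dist_norm norm_minus_commute)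
    qed
    fix \<phi> \<psi> assume S': "\<phi> \<in> S" "\<psi> \<in> S"
    show "dist (T \<phi>) (T \<psi>) \<le> 1/2 * dist \<phi> \<psi>"
    proof (rule dist_bound)
      fix t
      have "dist (T \<phi> t) (T \<psi> t) = norm ((J \<phi> (c t) - J \<psi> (c t)) - (J \<phi> 0 - J \<psi> 0))"
        using S' by (simp add: T dist_norm algebra_simps)
      also have "\<dots> \<le> (L * dist \<phi> \<psi>) * (c t + \<epsilon>) + (L * dist \<phi> \<psi>) * (0 + \<epsilon>)"
        using J_lip[OF S' c[of t]] J_lip[OF S' zero]
          norm_triangle_ineq4[of "J \<phi> (c t) - J \<psi> (c t)" "J \<phi> 0 - J \<psi> 0"] by linarith
      also have "\<dots> \<le> (L * dist \<phi> \<psi>) * (\<epsilon> + \<epsilon>) + (L * dist \<phi> \<psi>) * (0 + \<epsilon>)"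
        using rL(2) c[of t] by (intro add_mono mult_left_mono) auto
      also have "\<dots> = (3 * \<epsilon> * L) * dist \<phi> \<psi>" by (simp add: algebra_simps)
      also have "\<dots> \<le> 1/2 * dist \<phi> \<psi>" using \<epsilon>L by (intro mult_right_mono) auto
      finally show "dist (T \<phi> t) (T \<psi> t) \<le> 1/2 * dist \<phi> \<psi>" .
    qed
  qed auto
  then obtain \<phi> where \<phi>: "\<phi> \<in> S" "T \<phi> = \<phi>" by auto
  have eq: "apply_bcontfun \<phi> t = x0 + (J \<phi> (c t) - J \<phi> 0)" for t
    using T[OF \<phi>(1)] \<phi>(2) by metis
  show thesis
  proof
    show "\<epsilon> > 0" by fact
    show "apply_bcontfun \<phi> 0 = x0" using eq[of 0] \<epsilon> by (simp add: c_def)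
    fix t assume t: "t \<in> {-\<epsilon><..<\<epsilon>}"
    show "apply_bcontfun \<phi> t \<in> U" using \<phi>(1) rL(3) by (auto simp: S)
    have "(J \<phi> has_vector_derivative X (apply_bcontfun \<phi> t)) (at t within {-\<epsilon>..\<epsilon>})"
      unfolding J_def using t by (intro integral_has_vector_derivative contX \<phi>) auto
    then have "(J \<phi> has_vector_derivative X (apply_bcontfun \<phi> t)) (at t)"
      using t by (simp add: at_within_Icc_at)
    then have "((\<lambda>t. x0 + (J \<phi> t - J \<phi> 0)) has_vector_derivative X (apply_bcontfun \<phi> t)) (at t)"
      by (auto intro!: derivative_eq_intros)
    then show "(apply_bcontfun \<phi> has_vector_derivative X (apply_bcontfun \<phi> t)) (at t)"
      by (rule has_vector_derivative_transform_within_open[OF _ _ t]) (auto simp: eq c_def)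
  qed
qed

text \<open>Bootstrapping: the derivative of y is \<open>X (y t)\<close>, so as long as X is regular
  enough each class reached by y yields the next one.\<close>

lemma Ck_on_solution:
  assumes fd: "finite_dim TYPE('e)" and I: "open I"
    and y: "\<And>t. t \<in> I \<Longrightarrow> y t \<in> U"
      "\<And>t. t \<in> I \<Longrightarrow> (y has_vector_derivative X (y t)) (at t)"
    and X: "Ck_on k U (X :: 'e::real_normed_vector \<Rightarrow> 'e)"
  shows "Ck_on (Suc k) I y"
proof -
  have cont: "Ck_on 0 I y"
    using y(2) by (auto intro!: continuous_at_imp_continuous_on has_vector_derivative_continuous)
  have step: "Ck_on (Suc j) I y" if "Ck_on j I y" "j \<le> k" for j
  proof (rule Ck_on_SucI[OF I])
    show "(y has_derivative (\<lambda>h. h *\<^sub>R X (y t))) (at t)" if "t \<in> I" for t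
      using y(2)[OF that] by (simp add: has_vector_derivative_def)
    have "Ck_on j U X" using that(2) X
      by (induction rule: inc_induct) (auto dest: Ck_on_Suc_imp simp del: Ck_on.simps)
    then show "Ck_on j I (\<lambda>t. h *\<^sub>R X (y t))" for h
      by (intro Ck_on_bounded_linear[OF I _ bounded_linear_scaleR_right] Ck_on_compose[OF fd I that(1) _ y(1)]) auto
  qed
  have "Ck_on j I y" if "j \<le> Suc k" for j
    using that
  proof (induction j)
    case 0
    show ?case by (rule cont)
  next
    case (Suc j)
    then show ?case by (intro step) auto
  qed
  then show ?thesis by blast
qed

section \<open>Smooth functions\<close>

lemmas smooth_on_Ck = iffD1[OF smooth_on_def, rule_format]

lemma smooth_on_cong:
  "open S \<Longrightarrow> (\<And>x. x \<in> S \<Longrightarrow> f x = g x) \<Longrightarrow> smooth_on S f \<Longrightarrow> smooth_on S g"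
  unfolding smooth_on_def using Ck_on_cong_imp by blast

lemma smooth_on_subset: "smooth_on S f \<Longrightarrow> T \<subseteq> S \<Longrightarrow> smooth_on T f"
  unfolding smooth_on_def using Ck_on_subset by blast

lemma smooth_on_local:
  "(\<And>x. x \<in> S \<Longrightarrow> \<exists>T. open T \<and> x \<in> T \<and> smooth_on T f) \<Longrightarrow> smooth_on S f"
  unfolding smooth_on_def by (metis Ck_on_local)

lemma smooth_on_compose:
  fixes f :: "'d::real_normed_vector \<Rightarrow> 'e::real_normed_vector"
  assumes "finite_dim TYPE('e)" "open S" "smooth_on S f" "smooth_on T g" "\<And>x. x \<in> S \<Longrightarrow> f x \<in> T"
  shows "smooth_on S (\<lambda>x. g (f x))"
  using assms Ck_on_compose[OF assms(1,2)] unfolding smooth_on_def by blast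

lemma smooth_on_const: "smooth_on S (\<lambda>x. c)"
  by (simp add: smooth_on_def Ck_on_const)

lemma smooth_on_linear: "bounded_linear L \<Longrightarrow> open S \<Longrightarrow> smooth_on S L"
  by (simp add: smooth_on_def Ck_on_linear)

lemma smooth_on_uminus: "open S \<Longrightarrow> smooth_on S f \<Longrightarrow> smooth_on S (\<lambda>x. - f x)"
  by (simp add: smooth_on_def Ck_on_uminus)

lemma smooth_on_diff:
  "open S \<Longrightarrow> smooth_on S f \<Longrightarrow> smooth_on S g \<Longrightarrow> smooth_on S (\<lambda>x. f x - g x)"
  by (simp add: smooth_on_def Ck_on_diff)

lemma smooth_on_sum:
  "open S \<Longrightarrow> (\<And>i. i \<in> J \<Longrightarrow> smooth_on S (f i)) \<Longrightarrow> smooth_on S (\<lambda>x. \<Sum>i\<in>J. f i x)"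
  by (simp add: smooth_on_def Ck_on_sum)

lemma smooth_on_scaleR:
  "open S \<Longrightarrow> smooth_on S f \<Longrightarrow> smooth_on S g \<Longrightarrow> smooth_on S (\<lambda>x. f x *\<^sub>R g x)"
  by (simp add: smooth_on_def Ck_on_scaleR)

lemma smooth_on_inverse:
  fixes f :: "'e::real_normed_vector \<Rightarrow> real"
  shows "open S \<Longrightarrow> (\<And>x. x \<in> S \<Longrightarrow> f x \<noteq> 0) \<Longrightarrow> smooth_on S f \<Longrightarrow> smooth_on S (\<lambda>x. inverse (f x))"
  by (simp add: smooth_on_def Ck_on_inverse)

lemma smooth_on_Pair:
  "open S \<Longrightarrow> smooth_on S f \<Longrightarrow> smooth_on S g \<Longrightarrow> smooth_on S (\<lambda>x. (f x, g x))"
  by (simp add: smooth_on_def Ck_on_Pair)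

lemma smooth_on_continuous: "smooth_on S f \<Longrightarrow> continuous_on S f"
  using Ck_on_continuous smooth_on_Ck by blast

lemma smooth_on_has_derivative:
  "smooth_on S f \<Longrightarrow> x \<in> S \<Longrightarrow> (f has_derivative frechet_derivative f (at x)) (at x)"
  using Ck_on_SucD(1) smooth_on_Ck by blast

text \<open>Covers derivatives at a moving point in a moving direction, as they occur in the natural
  transition maps and in the coefficients of the second-order field.\<close>

lemma smooth_on_frechet_apply:
  fixes F :: "'e::real_normed_vector \<Rightarrow> 'f::real_normed_vector" and g w :: "'d::real_normed_vector \<Rightarrow> 'e"
  assumes fd: "finite_dim TYPE('e)" and S: "open S"
    and F: "smooth_on T F" and w: "smooth_on S w" and g: "smooth_on S g" "\<And>x. x \<in> S \<Longrightarrow> g x \<in> T"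
  shows "smooth_on S (\<lambda>x. frechet_derivative F (at (g x)) (w x))"
  unfolding smooth_on_def
proof
  fix k
  show "Ck_on k S (\<lambda>x. frechet_derivative F (at (g x)) (w x))"
  proof (rule Ck_on_frechet_apply[OF fd S, where g=g])
    show "Ck_on (Suc k) T F" by (rule smooth_on_Ck[OF F])
    show "Ck_on k S w" by (rule smooth_on_Ck[OF w])
    show "g x \<in> T" if "x \<in> S" for x using g(2) that .
    show "Ck_on k S (\<lambda>x. frechet_derivative F (at (g x)) h)" for h
    proof (rule Ck_on_compose[OF fd S])
      show "Ck_on k S g" by (rule smooth_on_Ck[OF g(1)])
      show "Ck_on k T (\<lambda>x. frechet_derivative F (at x) h)"
        by (rule Ck_on_SucD(2)[OF smooth_on_Ck[OF F]])
      show "g x \<in> T" if "x \<in> S" for x using g(2) that .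
    qed
  qed
qed

section \<open>Smooth dual frames\<close>

text \<open>Biorthogonalisation by induction on J: in place of an inner product the functionals
  themselves correct the vectors. Independence at y0 spreads because each new pivot stays nonzero on
  a smaller neighbourhood. Smoothness of the functionals is expressed by testing them on smooth
  vector-valued maps w.\<close>

lemma smooth_dual_frame:
  fixes l :: "'i \<Rightarrow> 'y::real_normed_vector \<Rightarrow> 'e::real_normed_vector \<Rightarrow> real"
  assumes "finite J" and S: "open S" "y0 \<in> S"
    and "\<And>i y. i \<in> J \<Longrightarrow> y \<in> S \<Longrightarrow> linear (l i y)"
    and "\<And>i T w. i \<in> J \<Longrightarrow> open T \<Longrightarrow> T \<subseteq> S \<Longrightarrow> smooth_on T w \<Longrightarrow> smooth_on T (\<lambda>y. l i y (w y))"
    and "\<And>a. (\<forall>u. (\<Sum>i\<in>J. a i * l i y0 u) = 0) \<Longrightarrow> \<forall>i\<in>J. a i = 0"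
  shows "\<exists>T e. open T \<and> y0 \<in> T \<and> T \<subseteq> S \<and> (\<forall>j\<in>J. smooth_on T (e j)) \<and>
    (\<forall>y\<in>T. \<forall>i\<in>J. \<forall>j\<in>J. l i y (e j y) = (if i = j then 1 else 0))"
  using assms(1,4-)
proof (induction J rule: finite_induct)
  case empty
  then show ?case using S by auto
next
  case (insert k J)
  note lin = insert.prems(1) and sm = insert.prems(2) and ind = insert.prems(3)
  have "\<exists>T e. open T \<and> y0 \<in> T \<and> T \<subseteq> S \<and> (\<forall>j\<in>J. smooth_on T (e j)) \<and>
    (\<forall>y\<in>T. \<forall>i\<in>J. \<forall>j\<in>J. l i y (e j y) = (if i = j then 1 else 0))"
  proof (rule insert.IH)
    fix a assume a: "\<forall>u. (\<Sum>i\<in>J. a i * l i y0 u) = 0"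
    have "(\<Sum>i\<in>insert k J. (a(k := 0)) i * l i y0 u) = (\<Sum>i\<in>J. a i * l i y0 u)" for u
      using insert.hyps by (auto intro!: sum.cong)
    with a have "\<forall>i\<in>insert k J. (a(k := 0)) i = 0" by (intro ind) auto
    then show "\<forall>i\<in>J. a i = 0" using insert.hyps by (metis fun_upd_other insertCI)
  qed (use lin sm in auto)
  then obtain T e where T: "open T" "y0 \<in> T" "T \<subseteq> S" and e: "\<And>j. j \<in> J \<Longrightarrow> smooth_on T (e j)"
    and dual: "\<And>y i j. y \<in> T \<Longrightarrow> i \<in> J \<Longrightarrow> j \<in> J \<Longrightarrow> l i y (e j y) = (if i = j then 1 else 0)"
    by metis
  \<comment> \<open>This is u without its components along the old frame, so every
    \<open>l i y\<close> with i in J kills it.\<close>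
  define w where "w u y = u - (\<Sum>i\<in>J. l i y u *\<^sub>R e i y)" for u y
  have "\<exists>u. l k y0 (w u y0) \<noteq> 0"
  proof (rule ccontr)
    assume "\<nexists>u. l k y0 (w u y0) \<noteq> 0"
    then have *: "l k y0 (w u y0) = 0" for u by auto
    interpret linear "l k y0" using lin[of k y0] S by auto
    \<comment> \<open>If \<open>l k y0\<close> killed all corrected vectors, it would be the
      combination of the other functionals with coefficients \<open>l k y0 (e i y0)\<close>; the
      entry -1 turns this into a forbidden relation.\<close>
    define a where "a i = (if i = k then -1 else l k y0 (e i y0))" for i
    have "(\<Sum>i\<in>insert k J. a i * l i y0 u) = - l k y0 u + (\<Sum>i\<in>J. l k y0 (e i y0) * l i y0 u)" for u
      using insert.hyps by (auto simp: a_def intro!: sum.cong)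
    also have "\<dots> u = - l k y0 (w u y0)" for u by (simp add: w_def diff sum scale mult.commute)
    finally have "\<forall>i\<in>insert k J. a i = 0" using * by (intro ind) auto
    then show False by (auto simp: a_def)
  qed
  then obtain u where u: "l k y0 (w u y0) \<noteq> 0" by auto
  define s where "s y = l k y (w u y)" for y
  have smw: "smooth_on T (w u)"
    unfolding w_def using T sm e
    by (intro smooth_on_diff smooth_on_sum smooth_on_scaleR) (auto simp: smooth_on_const)
  have sms: "smooth_on T s" unfolding s_def using sm[of k T] T smw by auto
  \<comment> \<open>The vector u found at y0 is kept constant while the point moves; it still serves
    wherever the pivot s is nonzero.\<close>
  define T' where "T' = {y \<in> T. s y \<noteq> 0}"
  have "T' = T \<inter> s -` (- {0})" by (auto simp: T'_def)
  then have openT': "open T'"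
    using continuous_open_preimage[OF smooth_on_continuous[OF sms] T(1), of "- {0}"] by (simp add: open_Compl)
  have T': "y0 \<in> T'" "T' \<subseteq> T" "T' \<subseteq> S" using T u by (auto simp: T'_def s_def)
  define ek where "ek y = inverse (s y) *\<^sub>R w u y" for y
  \<comment> \<open>The correction makes \<open>l k y\<close> vanish on the old frame vectors and
    preserves their other pairings, since the functionals of J kill \<open>ek\<close>.\<close>
  define e' where "e' j y = (if j = k then ek y else e j y - l k y (e j y) *\<^sub>R ek y)" for j y
  have smek: "smooth_on T' ek"
    unfolding ek_def using openT' smooth_on_subset[OF smw T'(2)] smooth_on_subset[OF sms T'(2)]
    by (intro smooth_on_scaleR smooth_on_inverse) (auto simp: T'_def)
  have sme: "smooth_on T' (\<lambda>y. e j y - l k y (e j y) *\<^sub>R ek y)" if "j \<in> J" for j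
  proof -
    have ej: "smooth_on T' (e j)" using e[OF that] T' smooth_on_subset by blast
    then have "smooth_on T' (\<lambda>y. l k y (e j y))" using sm openT' T' by auto
    then show ?thesis by (rule smooth_on_diff[OF openT' ej smooth_on_scaleR[OF openT' _ smek]])
  qed
  have dual_ek: "l i y (ek y) = (if i = k then 1 else 0)" if "y \<in> T'" "i \<in> insert k J" for i y
  proof -
    interpret linear "l i y" using lin that T' by auto
    show ?thesis
    proof (cases "i = k")
      case True
      then show ?thesis using that scale[of "inverse (s y)" "w u y"] by (simp add: ek_def T'_def s_def)
    next
      case False
      then have i: "i \<in> J" using that by auto
      have "(\<Sum>j\<in>J. l j y u * l i y (e j y)) = (\<Sum>j\<in>J. if i = j then l j y u else 0)"
        using that T' i by (intro sum.cong) (auto simp: dual)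
      also have "\<dots> = l i y u" using i insert.hyps by simp
      finally show ?thesis using False by (simp add: ek_def w_def scale diff sum)
    qed
  qed
  show ?case
  proof (intro exI[of _ T'] exI[of _ e'] conjI ballI)
    show "smooth_on T' (e' j)" if "j \<in> insert k J" for j
      unfolding e'_def using smek sme that by (cases "j = k") auto
    show "l i y (e' j y) = (if i = j then 1 else 0)"
      if y: "y \<in> T'" and i: "i \<in> insert k J" and j: "j \<in> insert k J" for y i j
    proof (cases "j = k")
      case False
      interpret linear "l i y" using lin i y T' by auto
      have "i \<noteq> k \<Longrightarrow> l i y (e j y) = (if i = j then 1 else 0)" using dual[of y i j] y T' i j False by auto
      then show ?thesis using dual_ek[OF y i] False by (auto simp: e'_def diff scale)
    qed (use dual_ek[OF y i] in \<open>auto simp: e'_def\<close>)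
  qed (use openT' T' in auto)
qed

text \<open>Duality makes the \<open>e j\<close> independent, and there are as many as a spanning
  set has elements. A nonzero u killed by every \<open>l i\<close> lies outside their span, so
  adjoining it would give too many independent vectors.\<close>

lemma dual_family_separates:
  fixes l :: "'i \<Rightarrow> 'e::real_vector \<Rightarrow> real"
  assumes B: "finite (B :: 'e set)" "span B = UNIV" and J: "finite J" "card J = card B"
    and lin: "\<And>i. i \<in> J \<Longrightarrow> linear (l i)"
    and dual: "\<And>i j. i \<in> J \<Longrightarrow> j \<in> J \<Longrightarrow> l i (e j) = (if i = j then 1 else 0)"
    and u: "\<And>i. i \<in> J \<Longrightarrow> l i u = 0"
  shows "u = 0"
proof (rule ccontr)
  assume "u \<noteq> 0"
  have inj: "inj_on e J" using dual by (intro inj_onI) (metis zero_neq_one)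
  have coeff: "l i (\<Sum>j\<in>J. a j *\<^sub>R e j) = a i" if "i \<in> J" for a i
  proof -
    interpret linear "l i" using lin that by auto
    have "l i (\<Sum>j\<in>J. a j *\<^sub>R e j) = (\<Sum>j\<in>J. if i = j then a j else 0)"
      unfolding sum scale using that by (intro sum.cong) (auto simp: dual)
    then show ?thesis using that J by simp
  qed
  have "independent (e ` J)"
  proof (rule independent_if_scalars_zero)
    fix a x assume *: "(\<Sum>x\<in>e ` J. a x *\<^sub>R x) = 0" "x \<in> e ` J"
    then obtain i where i: "i \<in> J" "x = e i" by auto
    then show "a x = 0" using coeff[OF i(1), of "a \<circ> e"] *(1) linear_0[OF lin[OF i(1)]]
      by (simp add: sum.reindex[OF inj])
  qed (use J in auto)
  moreover have "u \<notin> span (e ` J)"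
  proof
    assume "u \<in> span (e ` J)"
    then obtain a where a: "u = (\<Sum>x\<in>e ` J. a x *\<^sub>R x)" using J by (auto simp: span_finite)
    then have a': "u = (\<Sum>j\<in>J. (a \<circ> e) j *\<^sub>R e j)" by (simp add: sum.reindex[OF inj])
    then have "(a \<circ> e) i = 0" if "i \<in> J" for i using coeff[OF that, of "a \<circ> e"] u[OF that] by simp
    then show False using a' \<open>u \<noteq> 0\<close> by simp
  qed
  ultimately have "independent (insert u (e ` J))" by (simp add: independent_insertI)
  from real_vector.independent_span_bound[OF B(1) this] B(2)
  have "card (insert u (e ` J)) \<le> card B" by simp
  moreover have "card (insert u (e ` J)) = Suc (card J)"
    using \<open>u \<notin> span (e ` J)\<close> J inj span_base[of u "e ` J"] by (subst card_insert_disjoint) (auto simp: card_image)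
  ultimately show False using J by simp
qed

section \<open>Charts and tangent vectors\<close>

lemma smooth_atlasD:
  assumes "smooth_atlas A" "c \<in> A" "d \<in> A"
  shows "inj_on (snd c) (fst c)" "open (snd c ` (fst c \<inter> fst d))"
    "smooth_on (snd c ` (fst c \<inter> fst d)) (transition c d)"
  using assms unfolding smooth_atlas_def by blast+

lemma chart_inv_snd: "smooth_atlas A \<Longrightarrow> c \<in> A \<Longrightarrow> p \<in> fst c \<Longrightarrow> chart_inv c (snd c p) = p"
  using smooth_atlasD(1) inv_into_f_f unfolding chart_inv_def by metis

lemma transition_snd:
  "smooth_atlas A \<Longrightarrow> c \<in> A \<Longrightarrow> p \<in> fst c \<Longrightarrow> transition c d (snd c p) = snd d p"
  by (simp add: transition_def chart_inv_snd)

lemma open_chart_domain: "smooth_atlas A \<Longrightarrow> c \<in> A \<Longrightarrow> open (snd c ` fst c)"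
  using smooth_atlasD(2)[of A c c] by simp

lemma open_chart_image:
  assumes "smooth_atlas A" "openin (atlas_topology A) P" "c \<in> A"
  shows "open (snd c ` (P \<inter> fst c))"
  using assms openin_atlas_topology[of A P] smooth_atlasD(1) by blast

lemma charts_at_iff: "c \<in> charts_at A p \<longleftrightarrow> c \<in> A \<and> p \<in> fst c"
  by (simp add: charts_at_def)

lemma charts_atD: "c \<in> charts_at A p \<Longrightarrow> c \<in> A" "c \<in> charts_at A p \<Longrightarrow> p \<in> fst c"
  by (auto simp: charts_at_def)

text \<open>On the overlap, g in the chart c is g in the chart d after the transition map.
  Coordinate maps g give the cocycle rule for transitions, functions g the chart independence of
  directional derivatives.\<close>

lemma chart_change_has_derivative:
  assumes A: "smooth_atlas A" and c: "c \<in> charts_at A p" and d: "d \<in> charts_at A p"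
    and g: "((g \<circ> chart_inv d) has_derivative g') (at (snd d p))"
  shows "((g \<circ> chart_inv c) has_derivative
    (\<lambda>x. g' (frechet_derivative (transition c d) (at (snd c p)) x))) (at (snd c p))"
proof -
  note cd = charts_atD[OF c] charts_atD[OF d]
  have "(transition c d has_derivative frechet_derivative (transition c d) (at (snd c p))) (at (snd c p))"
    by (rule smooth_on_has_derivative[OF smooth_atlasD(3)[OF A]]) (use cd in auto)
  moreover have "((g \<circ> chart_inv d) has_derivative g') (at (transition c d (snd c p)))"
    using g transition_snd[OF A cd(1,2), of d] by simp
  ultimately have "((\<lambda>x. (g \<circ> chart_inv d) (transition c d x)) has_derivative
      (\<lambda>x. g' (frechet_derivative (transition c d) (at (snd c p)) x))) (at (snd c p))"
    by (rule has_derivative_compose)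
  then show ?thesis
    by (rule has_derivative_transform_within_open[OF _ smooth_atlasD(2)[OF A cd(1,3)]])
      (use cd chart_inv_snd[OF A cd(1)] chart_inv_snd[OF A cd(3)] in \<open>auto simp: transition_def\<close>)
qed

lemma transition_has_derivative:
  assumes A: "smooth_atlas A" and c: "c \<in> charts_at A p" and d: "d \<in> charts_at A p"
  shows "(transition c d has_derivative frechet_derivative (transition c d) (at (snd c p))) (at (snd c p))"
  by (rule smooth_on_has_derivative[OF smooth_atlasD(3)[OF A]]) (use charts_atD[OF c] charts_atD[OF d] in auto)

lemma frechet_transition_chain:
  assumes A: "smooth_atlas A" and c: "c \<in> charts_at A p" and d: "d \<in> charts_at A p" and e: "e \<in> charts_at A p"
  shows "frechet_derivative (transition d e) (at (snd d p)) (frechet_derivative (transition c d) (at (snd c p)) x)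
    = frechet_derivative (transition c e) (at (snd c p)) x"
  using frechet_eqI[OF chart_change_has_derivative[OF A c d
      transition_has_derivative[OF A d e, unfolded transition_def[of d e]]]]
  by (simp add: transition_def)

lemma frechet_transition_refl:
  assumes A: "smooth_atlas A" and c: "c \<in> charts_at A p"
  shows "frechet_derivative (transition c c) (at (snd c p)) x = x"
proof -
  note c = charts_atD[OF c]
  have "(transition c c has_derivative (\<lambda>x. x)) (at (snd c p))"
    by (rule has_derivative_transform_within_open[OF has_derivative_ident open_chart_domain[OF A c(1)]])
      (use c transition_snd[OF A c(1), of _ c] in auto)
  from frechet_eqI[OF this] show ?thesis by simp
qed

text \<open>The inverse of the natural chart over c. The transition maps force the coordinates in
  the other charts at p, and the default 0 is that of \<open>tangent_space\<close>.\<close>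

definition tangent_of ::
  "('a, 'e::real_normed_vector) atlas \<Rightarrow> ('a, 'e) chart \<Rightarrow> 'a \<Rightarrow> 'e \<Rightarrow> ('a, 'e) tangent" where
  "tangent_of A c p x =
     (p, \<lambda>d. if d \<in> charts_at A p then frechet_derivative (transition c d) (at (snd c p)) x else 0)"

lemma fst_tangent_of [simp]: "fst (tangent_of A c p x) = p"
  by (simp add: tangent_of_def)

lemma tangent_of_coord:
  "smooth_atlas A \<Longrightarrow> c \<in> charts_at A p \<Longrightarrow> snd (tangent_of A c p x) c = x"
  by (simp add: tangent_of_def frechet_transition_refl)

lemma tangent_of_in_tangent_space:
  "smooth_atlas A \<Longrightarrow> c \<in> charts_at A p \<Longrightarrow> tangent_of A c p x \<in> tangent_space A p"
  unfolding tangent_space_def tangent_of_def mem_Collect_eq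
  by (intro conjI ballI allI impI) (auto simp: frechet_transition_chain carrier_def dest: charts_atD)

lemma tangent_space_fst: "w \<in> tangent_space A p \<Longrightarrow> fst w = p"
  unfolding tangent_space_def by simp

lemma tangent_space_outside:
  "w \<in> tangent_space A p \<Longrightarrow> c \<notin> charts_at A p \<Longrightarrow> snd w c = 0"
  unfolding tangent_space_def mem_Collect_eq by (elim conjE) (erule allE, erule (1) mp)

lemma tangent_space_transform:
  "w \<in> tangent_space A p \<Longrightarrow> c \<in> charts_at A p \<Longrightarrow> d \<in> charts_at A p \<Longrightarrow>
    snd w d = frechet_derivative (transition c d) (at (snd c p)) (snd w c)"
  unfolding tangent_space_def mem_Collect_eq by (elim conjE) (drule (1) bspec, drule (1) bspec)

text \<open>The transformation rule recovers all coordinates from one chart. The uniqueness of the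
  field is decided in this way.\<close>

lemma tangent_space_eqI:
  assumes "w \<in> tangent_space A p" "w' \<in> tangent_space A p" "c \<in> charts_at A p" "snd w c = snd w' c"
  shows "w = w'"
proof (rule prod_eqI)
  show "fst w = fst w'" using assms(1,2)[THEN tangent_space_fst] by simp
  show "snd w = snd w'"
  proof
    fix d
    show "snd w d = snd w' d"
    proof (cases "d \<in> charts_at A p")
      case True
      then show ?thesis
        using tangent_space_transform[OF assms(1,3) True] tangent_space_transform[OF assms(2,3) True] assms(4) by simp
    next
      case False
      then show ?thesis using assms(1,2)[THEN tangent_space_outside] by simp
    qed
  qed
qed

lemma tangent_bundle_iff: "w \<in> tangent_bundle A \<longleftrightarrow> w \<in> tangent_space A (fst w)"
  unfolding tangent_bundle_def tangent_space_def by simp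

section \<open>Natural charts of the tangent bundle\<close>

lemma tangent_chart_simps [simp]:
  "fst (tangent_chart A c) = {w \<in> tangent_bundle A. fst w \<in> fst c}"
  "snd (tangent_chart A c) w = (snd c (fst w), snd w c)"
  by (simp_all add: tangent_chart_def)

lemma tangent_of_in_tangent_chart:
  "smooth_atlas A \<Longrightarrow> c \<in> charts_at A p \<Longrightarrow> tangent_of A c p x \<in> fst (tangent_chart A c)"
  by (auto simp: tangent_bundle_iff tangent_of_in_tangent_space charts_atD)

lemma tangent_chart_charts_at:
  "w \<in> tangent_bundle A \<Longrightarrow> c \<in> charts_at A (fst w) \<Longrightarrow> tangent_chart A c \<in> charts_at (tangent_atlas A) w"
  by (auto simp: charts_at_def tangent_atlas_def)

lemma charts_at_tangent_atlasE:
  assumes "k \<in> charts_at (tangent_atlas A) w"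
  obtains c where "c \<in> charts_at A (fst w)" "k = tangent_chart A c" "w \<in> tangent_bundle A"
  using assms by (auto simp: charts_at_def tangent_atlas_def)

lemma inj_on_tangent_chart:
  assumes A: "smooth_atlas A" and c: "c \<in> A"
  shows "inj_on (snd (tangent_chart A c)) (fst (tangent_chart A c))"
proof (rule inj_onI)
  fix w w' assume w: "w \<in> fst (tangent_chart A c)" "w' \<in> fst (tangent_chart A c)"
    and eq: "snd (tangent_chart A c) w = snd (tangent_chart A c) w'"
  then have "fst w = fst w'" using smooth_atlasD(1)[OF A c c] by (auto simp: inj_on_def)
  with w eq c show "w = w'"
    by (intro tangent_space_eqI[of w A "fst w" w' c]) (auto simp: tangent_bundle_iff charts_at_def)
qed

text \<open>Every vector of the model space occurs as a fibre coordinate, through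
  \<open>tangent_of\<close>; hence a cylinder, open along with its base.\<close>

lemma tangent_chart_image:
  assumes A: "smooth_atlas A" and c: "c \<in> A"
  shows "snd (tangent_chart A c) ` (fst (tangent_chart A c) \<inter> fst (tangent_chart A d)) =
    snd c ` (fst c \<inter> fst d) \<times> UNIV"
proof (intro subset_antisym subsetI)
  fix y assume "y \<in> snd c ` (fst c \<inter> fst d) \<times> (UNIV :: 'b set)"
  then obtain p x where y: "y = (snd c p, x)" "p \<in> fst c" "p \<in> fst d" by auto
  have p: "c \<in> charts_at A p" using c y by (auto simp: charts_at_def)
  show "y \<in> snd (tangent_chart A c) ` (fst (tangent_chart A c) \<inter> fst (tangent_chart A d))"
  proof (rule image_eqI)
    show "y = snd (tangent_chart A c) (tangent_of A c p x)"
      using tangent_of_coord[OF A p] y by simp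
    show "tangent_of A c p x \<in> fst (tangent_chart A c) \<inter> fst (tangent_chart A d)"
      using tangent_of_in_tangent_chart[OF A p, of x] y by simp
  qed
qed auto

lemma chart_inv_tangent_chart:
  assumes A: "smooth_atlas A" and c: "c \<in> charts_at A p"
  shows "chart_inv (tangent_chart A c) (snd c p, x) = tangent_of A c p x"
proof -
  have "chart_inv (tangent_chart A c) (snd (tangent_chart A c) (tangent_of A c p x)) = tangent_of A c p x"
    unfolding chart_inv_def
    by (rule inv_into_f_f[OF inj_on_tangent_chart[OF A charts_atD(1)[OF c]] tangent_of_in_tangent_chart[OF A c]])
  then show ?thesis by (simp add: tangent_of_coord[OF A c])
qed

lemma transition_tangent_chart:
  assumes A: "smooth_atlas A" and c: "c \<in> A" and d: "d \<in> A"
    and y: "y \<in> snd c ` (fst c \<inter> fst d) \<times> UNIV"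
  shows "transition (tangent_chart A c) (tangent_chart A d) y =
    (transition c d (fst y), frechet_derivative (transition c d) (at (fst y)) (snd y))"
proof -
  obtain p x where p: "y = (snd c p, x)" "p \<in> fst c" "p \<in> fst d" using y by auto
  then have "c \<in> charts_at A p" "d \<in> charts_at A p" using c d by (auto simp: charts_at_def)
  then show ?thesis using p
    by (simp add: transition_def chart_inv_tangent_chart[OF A] chart_inv_snd[OF A c])
      (simp add: tangent_of_def transition_def)
qed

text \<open>The fibre part of a natural transition is a derivative at the moving point q in the
  moving direction v, which \<open>smooth_on_frechet_apply\<close> handles.\<close>

lemma smooth_atlas_tangent_atlas:
  fixes A :: "('a, 'e::real_normed_vector) atlas"
  assumes fd: "finite_dim TYPE('e)" and A: "smooth_atlas A"
  shows "smooth_atlas (tangent_atlas A)"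
proof -
  have "open (snd (tangent_chart A c) ` (fst (tangent_chart A c) \<inter> fst (tangent_chart A d))) \<and>
      smooth_on (snd (tangent_chart A c) ` (fst (tangent_chart A c) \<inter> fst (tangent_chart A d)))
        (transition (tangent_chart A c) (tangent_chart A d))"
    if c: "c \<in> A" and d: "d \<in> A" for c d
    unfolding tangent_chart_image[OF A c]
  proof
    let ?U = "snd c ` (fst c \<inter> fst d)"
    note T = smooth_atlasD(2,3)[OF A c d]
    show op: "open (?U \<times> (UNIV :: 'e set))" using T(1) by (intro open_Times) auto
    have fstU: "smooth_on (?U \<times> (UNIV :: 'e set)) fst"
      and sndU: "smooth_on (?U \<times> (UNIV :: 'e set)) snd"
      using op by (auto intro: smooth_on_linear bounded_linear_fst bounded_linear_snd)
    have "smooth_on (?U \<times> UNIV) (\<lambda>y. (transition c d (fst y),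
        frechet_derivative (transition c d) (at (fst y)) (snd y :: 'e)))"
    proof (rule smooth_on_Pair[OF op])
      show "smooth_on (?U \<times> UNIV) (\<lambda>y::'e\<times>'e. transition c d (fst y))"
        by (rule smooth_on_compose[OF fd op fstU T(2)]) auto
      show "smooth_on (?U \<times> UNIV) (\<lambda>y. frechet_derivative (transition c d) (at (fst y)) (snd y :: 'e))"
        by (rule smooth_on_frechet_apply[OF fd op T(2) sndU fstU]) auto
    qed
    then show "smooth_on (?U \<times> UNIV) (transition (tangent_chart A c) (tangent_chart A d))"
      by (rule smooth_on_cong[OF op, rotated]) (use transition_tangent_chart[OF A c d] in simp)
  qed
  then show ?thesis
    unfolding smooth_atlas_def tangent_atlas_def using inj_on_tangent_chart[OF A] by blast
qed

text \<open>\<open>smooth_map_on\<close> only grants some chart d at each point. Near that point f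
  in the prescribed chart c is f in d after a transition map, and smoothness is local.\<close>

lemma smooth_map_on_chart:
  fixes A :: "('a, 'e::real_normed_vector) atlas" and f :: "'a \<Rightarrow> 'f::real_normed_vector"
  assumes fd: "finite_dim TYPE('e)" and A: "smooth_atlas A" and P: "openin (atlas_topology A) P"
    and f: "smooth_map_on A model_atlas P f" and c: "c \<in> A"
  shows "smooth_on (snd c ` (P \<inter> fst c)) (f \<circ> chart_inv c)"
proof (rule smooth_on_local)
  fix x assume "x \<in> snd c ` (P \<inter> fst c)"
  then obtain p where p: "p \<in> P" "p \<in> fst c" "x = snd c p" by auto
  obtain d where d: "d \<in> charts_at A p" and sm: "smooth_on (snd d ` (P \<inter> fst d)) (f \<circ> chart_inv d)"
    using f p(1) by (fastforce simp: smooth_map_on_def model_atlas_def charts_at_def)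
  note dA = charts_atD[OF d]
  let ?T = "snd c ` (P \<inter> fst c) \<inter> snd c ` (fst c \<inter> fst d)"
  have T: "?T = snd c ` (P \<inter> fst c \<inter> fst d)"
    using smooth_atlasD(1)[OF A c c] by (auto simp: inj_on_def)
  have op: "open ?T" using open_chart_image[OF A P c] smooth_atlasD(2)[OF A c dA(1)] by auto
  have "smooth_on ?T (\<lambda>x. (f \<circ> chart_inv d) (transition c d x))"
    by (rule smooth_on_compose[OF fd op smooth_on_subset[OF smooth_atlasD(3)[OF A c dA(1)]] sm])
      (auto simp: transition_snd[OF A c] T)
  then have "smooth_on ?T (f \<circ> chart_inv c)"
    by (rule smooth_on_cong[OF op, rotated])
      (auto simp: transition_snd[OF A c] T chart_inv_snd[OF A] c dA)
  with op p dA show "\<exists>T. open T \<and> x \<in> T \<and> smooth_on T (f \<circ> chart_inv c)" by blast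
qed

lemma smooth_map_on_chart_has_derivative:
  fixes A :: "('a, 'e::real_normed_vector) atlas" and f :: "'a \<Rightarrow> 'f::real_normed_vector"
  assumes "finite_dim TYPE('e)" "smooth_atlas A" "openin (atlas_topology A) P"
    "smooth_map_on A model_atlas P f" and p: "p \<in> P" "c \<in> charts_at A p"
  shows "((f \<circ> chart_inv c) has_derivative frechet_derivative (f \<circ> chart_inv c) (at (snd c p))) (at (snd c p))"
  by (rule smooth_on_has_derivative[OF smooth_map_on_chart[OF assms(1-4)]]) (use p charts_atD[OF p(2)] in auto)

text \<open>The common value is the derivative of g along z; Lie derivatives may thus be computed in
  whichever chart is at hand.\<close>

lemma frechet_chart_independent:
  assumes A: "smooth_atlas A" and c: "c \<in> charts_at A p" and d: "d \<in> charts_at A p"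
    and g: "(g \<circ> chart_inv d) differentiable (at (snd d p))" and z: "z \<in> tangent_space A p"
  shows "frechet_derivative (g \<circ> chart_inv c) (at (snd c p)) (snd z c) =
    frechet_derivative (g \<circ> chart_inv d) (at (snd d p)) (snd z d)"
  using frechet_eqI[OF chart_change_has_derivative[OF A c d frechet_derivative_works'[OF g]]]
    tangent_space_transform[OF z c d] by simp

section \<open>Vector fields and integral curves\<close>

text \<open>Smoothness of Z is granted with a chart c on the source and a natural chart over a
  possibly different e on the target. The transition from e to c expresses both in e, where Z
  becomes an autonomous differential equation.\<close>

lemma vector_field_in_chart:
  fixes A :: "('a, 'e::real_normed_vector) atlas"
  assumes fd: "finite_dim TYPE('e)" and A: "smooth_atlas A" and Z: "vector_field_on A W Z" and p: "p \<in> W"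
  obtains e U where "e \<in> charts_at A p" "open U" "snd e p \<in> U" "U \<subseteq> snd e ` (W \<inter> fst e)"
    "smooth_on U (\<lambda>x. snd (Z (chart_inv e x)) e)"
proof -
  have W: "openin (atlas_topology A) W" and ZT: "\<And>p. p \<in> W \<Longrightarrow> Z p \<in> tangent_space A p"
    and "smooth_map_on A (tangent_atlas A) W Z" using Z by (auto simp: vector_field_on_def)
  then obtain c k where c: "c \<in> charts_at A p" and k: "k \<in> charts_at (tangent_atlas A) (Z p)"
    and op: "open (snd c ` (W \<inter> fst c \<inter> Z -` fst k))"
    and sm: "smooth_on (snd c ` (W \<inter> fst c \<inter> Z -` fst k)) (snd k \<circ> Z \<circ> chart_inv c)"
    using p unfolding smooth_map_on_def by meson
  obtain e where e: "e \<in> charts_at A p" and ke: "k = tangent_chart A e"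
    using charts_at_tangent_atlasE[OF k] tangent_space_fst[OF ZT[OF p]] by metis
  note cA = charts_atD[OF c] and eA = charts_atD[OF e]
  \<comment> \<open>Since \<open>Z\<close> sends a point to a vector over it, landing in the natural
    chart over e means that the point lies in e.\<close>
  have dom: "W \<inter> fst c \<inter> Z -` fst k = W \<inter> fst c \<inter> fst e"
    using ZT tangent_space_fst[OF ZT] by (auto simp: ke tangent_bundle_iff)
  let ?U = "snd e ` (W \<inter> fst e) \<inter> snd e ` (fst e \<inter> fst c)"
  have U: "?U = snd e ` (W \<inter> fst c \<inter> fst e)"
    using smooth_atlasD(1)[OF A eA(1) eA(1)] by (auto simp: inj_on_def)
  have opU: "open ?U" using open_chart_image[OF A W eA(1)] smooth_atlasD(2)[OF A eA(1) cA(1)] by auto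
  have sm2: "smooth_on (snd c ` (W \<inter> fst c \<inter> fst e)) (\<lambda>x. snd (Z (chart_inv c x)) e)"
  proof -
    have "smooth_on (snd c ` (W \<inter> fst c \<inter> fst e)) (\<lambda>x. snd ((snd k \<circ> Z \<circ> chart_inv c) x))"
      using sm op unfolding dom smooth_on_def by (auto intro: Ck_on_bounded_linear[OF _ _ bounded_linear_snd] simp del: comp_apply)
    then show ?thesis by (simp add: ke)
  qed
  show thesis
  proof
    show "e \<in> charts_at A p" "open ?U" by fact+
    show "snd e p \<in> ?U" using p cA eA by auto
    show "?U \<subseteq> snd e ` (W \<inter> fst e)" by auto
    have "smooth_on ?U (\<lambda>x. snd (Z (chart_inv c (transition e c x))) e)"
      by (rule smooth_on_compose[OF fd opU smooth_on_subset[OF smooth_atlasD(3)[OF A eA(1) cA(1)]] sm2])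
        (auto simp: U transition_snd[OF A eA(1)])
    then show "smooth_on ?U (\<lambda>x. snd (Z (chart_inv e x)) e)"
      by (rule smooth_on_cong[OF opU, rotated])
        (auto simp: transition_snd[OF A eA(1)] U chart_inv_snd[OF A] cA eA)
  qed
qed

lemma chart_inv_model [simp]: "chart_inv (UNIV, id) = id"
  by (simp add: chart_inv_def fun_eq_iff inv_into_def)

text \<open>The equation is solved in the coordinates of one chart and the solution is carried back
  by the inverse chart.\<close>

lemma integral_curve_exists:
  fixes A :: "('a, 'e::banach) atlas"
  assumes fd: "finite_dim TYPE('e)" and A: "smooth_atlas A" and Z: "vector_field_on A W Z" and p: "p \<in> W"
  obtains I \<gamma> where "integral_curve A W Z I \<gamma>" "0 \<in> I" "\<gamma> 0 = p"
proof -
  obtain e U where e: "e \<in> charts_at A p" and U: "open U" "snd e p \<in> U" "U \<subseteq> snd e ` (W \<inter> fst e)"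
    and sm: "smooth_on U (\<lambda>x. snd (Z (chart_inv e x)) e)"
    using vector_field_in_chart[OF fd A Z p] by metis
  have ZT: "\<And>p. p \<in> W \<Longrightarrow> Z p \<in> tangent_space A p" using Z by (auto simp: vector_field_on_def)
  note eA = charts_atD[OF e]
  obtain \<epsilon> y where \<epsilon>: "\<epsilon> > 0" and y0: "y 0 = snd e p"
    and yU: "\<And>t. t \<in> {-\<epsilon><..<\<epsilon>} \<Longrightarrow> y t \<in> U"
    and y': "\<And>t. t \<in> {-\<epsilon><..<\<epsilon>} \<Longrightarrow> (y has_vector_derivative snd (Z (chart_inv e (y t))) e) (at t)"
    using Picard_Lindelof[OF fd U(1,2) smooth_on_Ck[OF sm]] by metis
  define I where "I = {-\<epsilon><..<\<epsilon>}"
  have opI: "open I" by (simp add: I_def)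
  have smy: "smooth_on I y"
    unfolding smooth_on_def I_def
    by (rule allI, rule Ck_on_Suc_imp, rule Ck_on_solution[OF fd _ yU y' smooth_on_Ck[OF sm]]) auto
  define \<gamma> where "\<gamma> = chart_inv e \<circ> y"
  have \<gamma>: "\<gamma> t \<in> W" "\<gamma> t \<in> fst e" "snd e (\<gamma> t) = y t" if "t \<in> I" for t
    using U(3) yU[of t] that chart_inv_snd[OF A eA(1)] by (auto simp: \<gamma>_def I_def)
  have e\<gamma>: "e \<in> charts_at A (\<gamma> t)" if "t \<in> I" for t using \<gamma>[OF that] eA by (simp add: charts_at_def)
  have "integral_curve A W Z I \<gamma>"
    unfolding integral_curve_def
  proof (intro conjI ballI)
    show "open I" by fact
    show "is_interval I" by (simp add: I_def)
    show "\<gamma> ` I \<subseteq> W" using \<gamma> by auto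
    show "smooth_map_on model_atlas A I \<gamma>"
      unfolding smooth_map_on_def
    proof
      fix t assume t: "t \<in> I"
      have "I \<inter> UNIV \<inter> \<gamma> -` fst e = I" using \<gamma> by auto
      moreover have "smooth_on I (snd e \<circ> \<gamma>)"
        by (rule smooth_on_cong[OF opI _ smy]) (simp add: \<gamma>)
      ultimately show "\<exists>c\<in>charts_at model_atlas t. \<exists>d\<in>charts_at A (\<gamma> t).
          open (snd c ` (I \<inter> fst c \<inter> \<gamma> -` fst d)) \<and>
          smooth_on (snd c ` (I \<inter> fst c \<inter> \<gamma> -` fst d)) (snd d \<circ> \<gamma> \<circ> chart_inv c)"
        using opI e\<gamma>[OF t]
        by (intro bexI[of _ "(UNIV, id)"] bexI[of _ e]) (auto simp: charts_at_def model_atlas_def)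
    qed
    fix t assume t: "t \<in> I"
    show "velocity A \<gamma> t = Z (\<gamma> t)"
    proof (rule prod_eqI)
      show "fst (velocity A \<gamma> t) = fst (Z (\<gamma> t))"
        using tangent_space_fst[OF ZT[OF \<gamma>(1)[OF t]]] by (simp add: velocity_def)
      \<comment> \<open>The equation was solved in e, but a velocity has a component in every chart
        d at the point; the transition from e to d carries the equation over.\<close>
      have "vector_derivative (snd d \<circ> \<gamma>) (at t) = snd (Z (\<gamma> t)) d" if d: "d \<in> charts_at A (\<gamma> t)" for d
      proof (rule vector_derivative_at)
        have "(transition e d has_derivative frechet_derivative (transition e d) (at (y t))) (at (y t))"
          using transition_has_derivative[OF A e\<gamma>[OF t] d] \<gamma>[OF t] by simp
        from vector_derivative_diff_chain_within[OF y' has_derivative_at_withinI[OF this]] t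
        have "((transition e d \<circ> y) has_vector_derivative
            frechet_derivative (transition e d) (at (y t)) (snd (Z (\<gamma> t)) e)) (at t)"
          by (simp add: I_def \<gamma>_def)
        then show "((snd d \<circ> \<gamma>) has_vector_derivative snd (Z (\<gamma> t)) d) (at t)"
          using tangent_space_transform[OF ZT[OF \<gamma>(1)[OF t]] e\<gamma>[OF t] d] \<gamma>(3)[OF t]
          by (simp add: transition_def \<gamma>_def o_assoc)
      qed
      moreover have "snd (Z (\<gamma> t)) d = 0" if "d \<notin> charts_at A (\<gamma> t)" for d
        using tangent_space_outside[OF ZT[OF \<gamma>(1)[OF t]] that] .
      ultimately show "snd (velocity A \<gamma> t) = snd (Z (\<gamma> t))"
        by (auto simp: velocity_def)
    qed
  qed
  moreover have "\<gamma> 0 = p" using y0 chart_inv_snd[OF A eA] by (simp add: \<gamma>_def)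
  ultimately show thesis using that[of I \<gamma>] \<epsilon> by (auto simp: I_def)
qed

text \<open>An integral curve is known to be smooth in some chart d at the point. The chain rule is
  applied there, and chart independence moves the result to c.\<close>

lemma integral_curve_deriv:
  fixes A :: "('a, 'e::real_normed_vector) atlas" and f :: "'a \<Rightarrow> 'f::real_normed_vector"
  assumes fd: "finite_dim TYPE('e)" and A: "smooth_atlas A" and P: "openin (atlas_topology A) P"
    and f: "smooth_map_on A model_atlas P f" and WP: "W \<subseteq> P"
    and Z: "\<And>p. p \<in> W \<Longrightarrow> Z p \<in> tangent_space A p"
    and \<gamma>: "integral_curve A W Z I \<gamma>" and t: "t \<in> I" and c: "c \<in> charts_at A (\<gamma> t)"
  shows "((f \<circ> \<gamma>) has_vector_derivative
    frechet_derivative (f \<circ> chart_inv c) (at (snd c (\<gamma> t))) (snd (Z (\<gamma> t)) c)) (at t)"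
proof -
  have I: "open I" and \<gamma>W: "\<And>t. t \<in> I \<Longrightarrow> \<gamma> t \<in> W" and vel: "velocity A \<gamma> t = Z (\<gamma> t)"
    and sm: "smooth_map_on model_atlas A I \<gamma>" using \<gamma> t by (auto simp: integral_curve_def)
  obtain d where d: "d \<in> charts_at A (\<gamma> t)" and op: "open (I \<inter> \<gamma> -` fst d)"
    and "smooth_on (I \<inter> \<gamma> -` fst d) (snd d \<circ> \<gamma>)"
    using sm t unfolding smooth_map_on_def by (fastforce simp: model_atlas_def charts_at_def)
  then have "(snd d \<circ> \<gamma>) differentiable (at t)"
    using t smooth_on_has_derivative charts_atD[OF d] by (fastforce simp: differentiable_def)
  then have "((snd d \<circ> \<gamma>) has_vector_derivative vector_derivative (snd d \<circ> \<gamma>) (at t)) (at t)"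
    by (simp add: vector_derivative_works)
  also have "vector_derivative (snd d \<circ> \<gamma>) (at t) = snd (Z (\<gamma> t)) d"
    using arg_cong[OF vel, of "\<lambda>z. snd z d"] d by (simp add: velocity_def)
  finally have \<gamma>': "((snd d \<circ> \<gamma>) has_vector_derivative snd (Z (\<gamma> t)) d) (at t)" .
  have f': "((f \<circ> chart_inv d) has_derivative frechet_derivative (f \<circ> chart_inv d) (at (snd d (\<gamma> t)))) (at (snd d (\<gamma> t)))"
    by (rule smooth_map_on_chart_has_derivative[OF fd A P f _ d]) (use WP \<gamma>W t in auto)
  from vector_derivative_diff_chain_within[OF \<gamma>' has_derivative_at_withinI, OF f'[folded comp_apply[of "snd d" \<gamma>]]]
  have "((f \<circ> chart_inv d \<circ> (snd d \<circ> \<gamma>)) has_vector_derivative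
      frechet_derivative (f \<circ> chart_inv d) (at (snd d (\<gamma> t))) (snd (Z (\<gamma> t)) d)) (at t)"
    by (simp add: comp_def)
  then have "((f \<circ> \<gamma>) has_vector_derivative
      frechet_derivative (f \<circ> chart_inv d) (at (snd d (\<gamma> t))) (snd (Z (\<gamma> t)) d)) (at t)"
    by (rule has_vector_derivative_transform_within_open[OF _ op])
      (use t charts_atD[OF d] chart_inv_snd[OF A] in auto)
  moreover have "(f \<circ> chart_inv d) differentiable (at (snd d (\<gamma> t)))" using f' by (auto simp: differentiable_def)
  ultimately show ?thesis
    using frechet_chart_independent[OF A c d _ Z[OF \<gamma>W[OF t]], of f] by simp
qed

text \<open>The derivative of f along an integral curve is the Lie derivative, so one chart per
  point decides its vanishing; on an interval this forces a constant.\<close>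

lemma constant_of_motionI:
  fixes A :: "('a, 'e::real_normed_vector) atlas"
  assumes fd: "finite_dim TYPE('e)" and A: "smooth_atlas A" and P: "openin (atlas_topology A) P"
    and f: "smooth_map_on A model_atlas P f" and WP: "W \<subseteq> P"
    and Z: "\<And>p. p \<in> W \<Longrightarrow> Z p \<in> tangent_space A p"
    and 0: "\<And>p. p \<in> W \<Longrightarrow> \<exists>c\<in>charts_at A p. frechet_derivative (f \<circ> chart_inv c) (at (snd c p)) (snd (Z p) c) = 0"
  shows "constant_of_motion A W Z f"
  unfolding constant_of_motion_def
proof (intro allI impI)
  fix I \<gamma> assume \<gamma>: "integral_curve A W Z I \<gamma>"
  then have I: "convex I" and \<gamma>W: "\<And>t. t \<in> I \<Longrightarrow> \<gamma> t \<in> W"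
    by (auto simp: integral_curve_def is_interval_convex)
  have "((f \<circ> \<gamma>) has_vector_derivative 0) (at t)" if t: "t \<in> I" for t
    using 0[OF \<gamma>W[OF t]] integral_curve_deriv[OF fd A P f WP Z \<gamma> t] by metis
  then have "((f \<circ> \<gamma>) has_derivative (\<lambda>h. 0)) (at t within I)" if "t \<in> I" for t
    using that by (auto simp: has_vector_derivative_def intro: has_derivative_at_withinI)
  from has_derivative_zero_constant[OF I this] show "(f \<circ> \<gamma>) constant_on I"
    by (simp add: constant_on_def)
qed

text \<open>The number in question is the derivative at time 0 of f along an integral curve through
  p.\<close>

lemma constant_of_motionD:
  fixes A :: "('a, 'e::banach) atlas"
  assumes fd: "finite_dim TYPE('e)" and A: "smooth_atlas A" and P: "openin (atlas_topology A) P"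
    and f: "smooth_map_on A model_atlas P f" and WP: "W \<subseteq> P"
    and Z: "vector_field_on A W Z" and cm: "constant_of_motion A W Z f"
    and p: "p \<in> W" "c \<in> charts_at A p"
  shows "frechet_derivative (f \<circ> chart_inv c) (at (snd c p)) (snd (Z p) c) = 0"
proof -
  obtain I \<gamma> where \<gamma>: "integral_curve A W Z I \<gamma>" "0 \<in> I" "\<gamma> 0 = p"
    using integral_curve_exists[OF fd A Z p(1)] by metis
  have ZT: "\<And>p. p \<in> W \<Longrightarrow> Z p \<in> tangent_space A p" using Z by (auto simp: vector_field_on_def)
  have "((f \<circ> \<gamma>) has_vector_derivative
    frechet_derivative (f \<circ> chart_inv c) (at (snd c p)) (snd (Z p) c)) (at 0)"
    using integral_curve_deriv[OF fd A P f WP ZT \<gamma>(1,2), of c] p(2) \<gamma>(3) by simp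
  moreover obtain k where k: "\<And>t. t \<in> I \<Longrightarrow> (f \<circ> \<gamma>) t = k"
    using cm \<gamma>(1) unfolding constant_of_motion_def constant_on_def by meson
  have "((f \<circ> \<gamma>) has_vector_derivative 0) (at 0)"
    by (rule has_vector_derivative_transform_within_open[of "\<lambda>_. k" _ _ I])
      (use k \<gamma> in \<open>auto simp: integral_curve_def intro: has_vector_derivative_const\<close>)
  ultimately show ?thesis by (metis vector_derivative_at)
qed

section \<open>Vector fields prescribed in a chart\<close>

lemma openin_smooth_atlas:
  "smooth_atlas A \<Longrightarrow>
    openin (atlas_topology A) S \<longleftrightarrow> S \<subseteq> carrier A \<and> (\<forall>c\<in>A. open (snd c ` (S \<inter> fst c)))"
  by (rule openin_atlas_topology) (rule smooth_atlasD(1))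

text \<open>In another chart d the set becomes the preimage of T under the transition from d to c,
  within the open overlap.\<close>

lemma openin_chart_preimage:
  assumes A: "smooth_atlas A" and c: "c \<in> A" and T: "open T"
  shows "openin (atlas_topology A) {p \<in> fst c. snd c p \<in> T}"
proof -
  let ?W = "{p \<in> fst c. snd c p \<in> T}"
  have "open (snd d ` (?W \<inter> fst d))" if d: "d \<in> A" for d
  proof -
    have "snd d ` (?W \<inter> fst d) = snd d ` (fst d \<inter> fst c) \<inter> transition d c -` T"
      using transition_snd[OF A d, of _ c] by auto
    then show ?thesis
      using continuous_open_preimage[OF smooth_on_continuous[OF smooth_atlasD(3)[OF A d c]] smooth_atlasD(2)[OF A d c] T]
      by simp
  qed
  moreover have "?W \<subseteq> carrier A" using c by (auto simp: carrier_def)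
  ultimately show ?thesis by (simp add: openin_smooth_atlas[OF A])
qed

text \<open>With c on the source and the natural chart over c on the target, the field reads x |->
  (x, X x).\<close>

lemma vector_field_onI:
  assumes A: "smooth_atlas A" and c: "c \<in> A" and T: "open T" "T \<subseteq> snd c ` fst c" and X: "smooth_on T X"
  shows "vector_field_on A {p \<in> fst c. snd c p \<in> T} (\<lambda>p. tangent_of A c p (X (snd c p)))"
    (is "vector_field_on A ?W ?Z")
  unfolding vector_field_on_def
proof (intro conjI ballI)
  show "openin (atlas_topology A) ?W" by (rule openin_chart_preimage[OF A c T(1)])
  have at: "c \<in> charts_at A p" if "p \<in> ?W" for p using that c by (simp add: charts_at_iff)
  then show ZT: "?Z p \<in> tangent_space A p" if "p \<in> ?W" for p
    using tangent_of_in_tangent_space[OF A] that by blast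
  show "smooth_map_on A (tangent_atlas A) ?W ?Z"
    unfolding smooth_map_on_def
  proof
    fix p assume p: "p \<in> ?W"
    let ?k = "tangent_chart A c"
    have dom: "?W \<inter> fst c \<inter> ?Z -` fst ?k = ?W"
      using tangent_of_in_tangent_chart[OF A at] by auto
    have img: "snd c ` ?W = T" using T(2) by auto
    have "smooth_on T (\<lambda>x. (x, X x))"
      by (rule smooth_on_Pair[OF T(1) smooth_on_linear[OF bounded_linear_ident T(1)] X])
    then have "smooth_on T (snd ?k \<circ> ?Z \<circ> chart_inv c)"
    proof (rule smooth_on_cong[OF T(1), rotated])
      fix x assume "x \<in> T"
      then obtain p where p: "p \<in> ?W" "x = snd c p" using img by blast
      then show "(x, X x) = (snd ?k \<circ> ?Z \<circ> chart_inv c) x"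
        using chart_inv_snd[OF A c, of p] tangent_of_coord[OF A at[OF p(1)]] by simp
    qed
    moreover have "?k \<in> charts_at (tangent_atlas A) (?Z p)"
      by (rule tangent_chart_charts_at)
        (use tangent_of_in_tangent_space[OF A at[OF p]] at[OF p] in \<open>simp_all add: tangent_bundle_iff\<close>)
    ultimately show "\<exists>c\<in>charts_at A p. \<exists>d\<in>charts_at (tangent_atlas A) (?Z p).
        open (snd c ` (?W \<inter> fst c \<inter> ?Z -` fst d)) \<and>
        smooth_on (snd c ` (?W \<inter> fst c \<inter> ?Z -` fst d)) (snd d \<circ> ?Z \<circ> chart_inv c)"
      using T(1) by (intro bexI[OF _ at[OF p]] bexI[of _ ?k]) (simp_all only: dom img simp_thms)
  qed
qed

section \<open>Second-order vector fields\<close>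

lemma tangent_bundle_chart:
  assumes "w \<in> tangent_bundle A"
  obtains c where "c \<in> charts_at A (fst w)"
  using assms unfolding tangent_bundle_def tangent_space_def carrier_def charts_at_def by auto

lemma base_has_derivative:
  assumes A: "smooth_atlas A" and c: "c \<in> charts_at A p" and d: "d \<in> charts_at A p"
  shows "((\<lambda>y. transition c d (fst y)) has_derivative
    (\<lambda>h. frechet_derivative (transition c d) (at (snd c p)) (fst h))) (at (snd c p, x))"
  by (rule has_derivative_compose[where f=fst, OF bounded_linear_imp_has_derivative[OF bounded_linear_fst]])
    (use transition_has_derivative[OF A c d] in simp)

text \<open>The base part of a natural transition depends on q alone. Its derivative therefore
  transforms the first halves of the coordinates of z like a tangent vector of the manifold itself,
  namely the projection of z.\<close>

lemma base_coord_transform: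
  fixes A :: "('a, 'e::real_normed_vector) atlas"
  assumes fd: "finite_dim TYPE('e)" and A: "smooth_atlas A"
    and w: "w \<in> tangent_bundle A" and z: "z \<in> tangent_space (tangent_atlas A) w"
    and c: "c \<in> charts_at A (fst w)" and d: "d \<in> charts_at A (fst w)"
  shows "fst (snd z (tangent_chart A d)) =
    frechet_derivative (transition c d) (at (snd c (fst w))) (fst (snd z (tangent_chart A c)))"
proof -
  let ?c = "tangent_chart A c" and ?d = "tangent_chart A d"
  note cA = charts_atD[OF c] and dA = charts_atD[OF d]
  note cd = tangent_chart_charts_at[OF w c] tangent_chart_charts_at[OF w d]
  have y: "snd ?c w = (snd c (fst w), snd w c)" by simp
  note T = transition_has_derivative[OF smooth_atlas_tangent_atlas[OF fd A] cd]
  have op: "open (snd c ` (fst c \<inter> fst d) \<times> (UNIV :: 'e set))"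
    using smooth_atlasD(2)[OF A cA(1) dA(1)] by (intro open_Times) auto
  have "((\<lambda>y. fst (transition ?c ?d y)) has_derivative
      (\<lambda>h. fst (frechet_derivative (transition ?c ?d) (at (snd ?c w)) h))) (at (snd ?c w))"
    by (rule bounded_linear.has_derivative[OF bounded_linear_fst T])
  then have "((\<lambda>y. transition c d (fst y)) has_derivative
      (\<lambda>h. fst (frechet_derivative (transition ?c ?d) (at (snd ?c w)) h))) (at (snd ?c w))"
    by (rule has_derivative_transform_within_open[OF _ op])
      (use cA dA transition_tangent_chart[OF A cA(1) dA(1)] in auto)
  from has_derivative_unique[OF this] base_has_derivative[OF A c d]
  have "(\<lambda>h. fst (frechet_derivative (transition ?c ?d) (at (snd ?c w)) h)) =
      (\<lambda>h. frechet_derivative (transition c d) (at (snd c (fst w))) (fst h))"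
    unfolding y by blast
  then show ?thesis
    using tangent_space_transform[OF z cd] by (metis (no_types))
qed

text \<open>\<open>tangent_map\<close> picks its source chart by \<open>SOME\<close>; the
  transformation rule for base parts removes the dependence on that choice.\<close>

lemma tangent_map_fst:
  fixes A :: "('a, 'e::real_normed_vector) atlas"
  assumes fd: "finite_dim TYPE('e)" and A: "smooth_atlas A"
    and w: "w \<in> tangent_bundle A" and z: "z \<in> tangent_space (tangent_atlas A) w"
  shows "tangent_map (tangent_atlas A) A fst z =
    (fst w, \<lambda>d. if d \<in> charts_at A (fst w) then fst (snd z (tangent_chart A d)) else 0)"
proof -
  define k where "k = (SOME k. k \<in> charts_at (tangent_atlas A) w)"
  obtain c0 where "c0 \<in> charts_at A (fst w)" using tangent_bundle_chart[OF w] .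
  then have "k \<in> charts_at (tangent_atlas A) w"
    unfolding k_def using tangent_chart_charts_at[OF w] someI by metis
  then obtain c where c: "c \<in> charts_at A (fst w)" and k: "k = tangent_chart A c"
    using charts_at_tangent_atlasE by blast
  note cA = charts_atD[OF c]
  have op: "open (snd c ` fst c \<times> (UNIV :: 'e set))"
    using open_chart_domain[OF A cA(1)] by (intro open_Times) auto
  have "frechet_derivative (snd d \<circ> fst \<circ> chart_inv k) (at (snd k w)) (snd z k) = fst (snd z (tangent_chart A d))"
    if d: "d \<in> charts_at A (fst w)" for d
  proof -
    have "((\<lambda>y. transition c d (fst y)) has_derivative
        (\<lambda>h. frechet_derivative (transition c d) (at (snd c (fst w))) (fst h))) (at (snd k w))"
      using base_has_derivative[OF A c d] by (simp add: k)
    then have "((snd d \<circ> fst \<circ> chart_inv k) has_derivative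
        (\<lambda>h. frechet_derivative (transition c d) (at (snd c (fst w))) (fst h))) (at (snd k w))"
    proof (rule has_derivative_transform_within_open[OF _ op])
      show "snd k w \<in> snd c ` fst c \<times> UNIV" using cA by (simp add: k)
      fix y assume "y \<in> snd c ` fst c \<times> (UNIV :: 'e set)"
      then obtain p x where y: "y = (snd c p, x)" "p \<in> fst c" by auto
      then have "c \<in> charts_at A p" using cA by (simp add: charts_at_iff)
      then show "transition c d (fst y) = (snd d \<circ> fst \<circ> chart_inv k) y"
        using y transition_snd[OF A cA(1) y(2), of d] by (simp add: k chart_inv_tangent_chart[OF A])
    qed
    from frechet_eqI[OF this] base_coord_transform[OF fd A w z c d] show ?thesis by (simp add: k)
  qed
  then show ?thesis
    unfolding tangent_map_def tangent_space_fst[OF z] k_def[symmetric] Let_def by auto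
qed

text \<open>The base part of \<open>Z w\<close> and the coordinates of w change charts by the same
  rule, so agreement in one chart is agreement in all.\<close>

lemma second_orderI:
  fixes A :: "('a, 'e::real_normed_vector) atlas"
  assumes fd: "finite_dim TYPE('e)" and A: "smooth_atlas A"
    and W: "W \<subseteq> tangent_bundle A" and Z: "\<And>w. w \<in> W \<Longrightarrow> Z w \<in> tangent_space (tangent_atlas A) w"
    and c: "\<And>w. w \<in> W \<Longrightarrow> \<exists>c\<in>charts_at A (fst w). fst (snd (Z w) (tangent_chart A c)) = snd w c"
  shows "second_order A W Z"
  unfolding second_order_def
proof
  fix w assume wW: "w \<in> W"
  then have w: "w \<in> tangent_bundle A" using W by auto
  then have wT: "w \<in> tangent_space A (fst w)" by (simp add: tangent_bundle_iff)
  obtain c where c: "c \<in> charts_at A (fst w)" and cw: "fst (snd (Z w) (tangent_chart A c)) = snd w c"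
    using c[OF wW] by auto
  have "fst (snd (Z w) (tangent_chart A d)) = snd w d" if "d \<in> charts_at A (fst w)" for d
    using base_coord_transform[OF fd A w Z[OF wW] c that] tangent_space_transform[OF wT c that] cw by simp
  then show "tangent_map (tangent_atlas A) A fst (Z w) = w"
    unfolding tangent_map_fst[OF fd A w Z[OF wW]]
    using tangent_space_outside[OF wT] by (intro prod_eqI) (auto simp: fun_eq_iff simp del: split_paired_All)
qed

lemma second_orderD:
  fixes A :: "('a, 'e::real_normed_vector) atlas"
  assumes fd: "finite_dim TYPE('e)" and A: "smooth_atlas A"
    and Z: "second_order A W Z" and w: "w \<in> W" "w \<in> tangent_bundle A" "Z w \<in> tangent_space (tangent_atlas A) w"
    and c: "c \<in> charts_at A (fst w)"
  shows "fst (snd (Z w) (tangent_chart A c)) = snd w c"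
proof -
  have "tangent_map (tangent_atlas A) A fst (Z w) = w" using Z w(1) by (simp add: second_order_def)
  then have "snd w c = snd (tangent_map (tangent_atlas A) A fst (Z w)) c" by simp
  then show ?thesis unfolding tangent_map_fst[OF fd A w(2,3)] using c by simp
qed

section \<open>Fibre derivatives in natural coordinates\<close>

lemma openin_tangent_atlas_subset:
  fixes A :: "('a, 'e::real_normed_vector) atlas"
  assumes fd: "finite_dim TYPE('e)" and A: "smooth_atlas A" and P: "openin (atlas_topology (tangent_atlas A)) P"
  shows "P \<subseteq> tangent_bundle A"
proof -
  have "P \<subseteq> carrier (tangent_atlas A)"
    using P by (simp add: openin_smooth_atlas[OF smooth_atlas_tangent_atlas[OF fd A]])
  also have "\<dots> \<subseteq> tangent_bundle A" by (auto simp: carrier_def tangent_atlas_def)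
  finally show ?thesis .
qed

text \<open>Transition derivatives are linear, so w + t u, formed in all charts at once, is a
  straight vertical line in the natural chart; the chain rule along it applies.\<close>

lemma fibre_derivative_chart:
  fixes A :: "('a, 'e::real_normed_vector) atlas"
  assumes fd: "finite_dim TYPE('e)" and A: "smooth_atlas A" and P: "openin (atlas_topology (tangent_atlas A)) P"
    and f: "smooth_map_on (tangent_atlas A) model_atlas P f" and w: "w \<in> P"
    and c: "c \<in> charts_at A (fst w)" and u: "u \<in> tangent_space A (fst w)"
  shows "fibre_derivative A f w u =
    frechet_derivative (f \<circ> chart_inv (tangent_chart A c)) (at (snd (tangent_chart A c) w)) (0, snd u c)"
proof -
  let ?k = "tangent_chart A c"
  let ?F = "f \<circ> chart_inv ?k"
  let ?y = "\<lambda>t::real. (snd c (fst w), snd w c + t *\<^sub>R snd u c)"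
  have wB: "w \<in> tangent_bundle A" using openin_tangent_atlas_subset[OF fd A P] w by auto
  then have wT: "w \<in> tangent_space A (fst w)" by (simp add: tangent_bundle_iff)
  have line: "chart_inv ?k (?y t) = (fst w, \<lambda>d. snd w d + t *\<^sub>R snd u d)" for t
  proof -
    have "snd (tangent_of A c (fst w) (snd w c + t *\<^sub>R snd u c)) d = snd w d + t *\<^sub>R snd u d" for d
    proof (cases "d \<in> charts_at A (fst w)")
      case True
      interpret D: bounded_linear "frechet_derivative (transition c d) (at (snd c (fst w)))"
        using transition_has_derivative[OF A c True] by (rule has_derivative_bounded_linear)
      show ?thesis using True
        by (simp add: tangent_of_def D.add D.scale tangent_space_transform[OF wT c True] tangent_space_transform[OF u c True])
    next
      case False
      then show ?thesis
        using tangent_space_outside[OF wT] tangent_space_outside[OF u] by (simp add: tangent_of_def)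
    qed
    then show ?thesis unfolding chart_inv_tangent_chart[OF A c] by (intro prod_eqI) auto
  qed
  have F: "(?F has_derivative frechet_derivative ?F (at (snd ?k w))) (at (snd ?k w))"
    by (rule smooth_map_on_chart_has_derivative[OF finite_dim_prod[OF fd fd] smooth_atlas_tangent_atlas[OF fd A] P f w])
      (rule tangent_chart_charts_at[OF wB c])
  have "(?y has_derivative (\<lambda>t. (0, t *\<^sub>R snd u c))) (at 0)"
    by (auto intro!: derivative_eq_intros has_derivative_Pair)
  from has_derivative_compose[OF this, of ?F "frechet_derivative ?F (at (snd ?k w))"] F
  have "((\<lambda>t. ?F (?y t)) has_derivative (\<lambda>t. frechet_derivative ?F (at (snd ?k w)) (0, t *\<^sub>R snd u c))) (at 0)"
    by simp
  moreover have "frechet_derivative ?F (at (snd ?k w)) (0, t *\<^sub>R snd u c) =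
      frechet_derivative ?F (at (snd ?k w)) (0, snd u c) * t" for t
    using linear_scale[OF has_derivative_linear[OF F], of t "(0, snd u c)"] by simp
  ultimately have "((\<lambda>t. f (fst w, \<lambda>d. snd w d + t *\<^sub>R snd u d)) has_field_derivative
      frechet_derivative ?F (at (snd ?k w)) (0, snd u c)) (at 0)"
    by (simp add: has_field_derivative_def line)
  then show ?thesis
    unfolding fibre_derivative_def using u by (simp add: DERIV_imp_deriv)
qed

section \<open>Existence and uniqueness of the second-order field\<close>

theorem theorem7:
  fixes m :: nat
    and A :: "('a, 'e::banach) atlas"
    and P :: "('a, 'e) tangent set"
    and f :: "nat \<Rightarrow> ('a, 'e) tangent \<Rightarrow> real"
    and v :: "('a, 'e) tangent"
  assumes "smooth_manifold m A"
    and "openin (atlas_topology (tangent_atlas A)) P"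
    and "fst ` P = carrier A"
    and "\<And>i. i \<in> {1..m} \<Longrightarrow> smooth_map_on (tangent_atlas A) model_atlas P (f i)"
    and "\<And>w. w \<in> P \<Longrightarrow>
           independent_covectors A (fst w) {1..m} (\<lambda>i. fibre_derivative A (f i) w)"
    and "v \<in> P"
  shows "\<exists>W Z. local_vector_field (tangent_atlas A) P v W Z \<and> second_order A W Z \<and>
           (\<forall>i\<in>{1..m}. constant_of_motion (tangent_atlas A) W Z (f i)) \<and>
           (\<forall>W' Z'. local_vector_field (tangent_atlas A) P v W' Z' \<and> second_order A W' Z' \<and>
              (\<forall>i\<in>{1..m}. constant_of_motion (tangent_atlas A) W' Z' (f i)) \<longrightarrow>
              (\<forall>w\<in>W \<inter> W'. Z' w = Z w))"
proof -
  note P = assms(2) and f = assms(4) and v = assms(6)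
  obtain B :: "'e set" where B: "finite B" "span B = UNIV" "card B = m"
    using assms(1) by (auto simp: smooth_manifold_def)
  have A: "smooth_atlas A" using assms(1) by (simp add: smooth_manifold_def)
  have fd: "finite_dim TYPE('e)" using B by (auto simp: finite_dim_def)
  define N where "N = tangent_atlas A"
  note N = smooth_atlas_tangent_atlas[OF fd A, folded N_def] and fdN = finite_dim_prod[OF fd fd]
  note P = P[folded N_def] and f = f[folded N_def]
  have PB: "P \<subseteq> tangent_bundle A" using openin_tangent_atlas_subset[OF fd A] P by (simp add: N_def)
  obtain c where cv: "c \<in> charts_at A (fst v)" using tangent_bundle_chart v PB by blast
  note cA = charts_atD(1)[OF cv]
  define k where "k = tangent_chart A c"
  have kN: "k \<in> N" using cA by (simp add: k_def N_def tangent_atlas_def)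
  have snd_k: "snd k w = (snd c (fst w), snd w c)" for w by (simp add: k_def)
  have fst_k: "w \<in> fst k \<longleftrightarrow> w \<in> tangent_bundle A \<and> c \<in> charts_at A (fst w)" for w
    using cA by (simp add: k_def charts_at_iff)
  have k_at: "k \<in> charts_at N w" if "w \<in> fst k" for w using that kN by (simp add: charts_at_iff)
  have vk: "v \<in> fst k" using fst_k cv v PB by auto
  define S where "S = snd k ` (P \<inter> fst k)"
  have S: "open S" "snd k v \<in> S" using open_chart_image[OF N P kN] v vk by (auto simp: S_def)
  define F where "F i = f i \<circ> chart_inv k" for i
  have F: "smooth_on S (F i)" if "i \<in> {1..m}" for i
    unfolding S_def F_def by (rule smooth_map_on_chart[OF fdN N P f[OF that] kN])
  define D where "D i y = frechet_derivative (F i) (at y)" for i y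
  have linD: "linear (D i y)" if "i \<in> {1..m}" "y \<in> S" for i y
    using has_derivative_linear[OF smooth_on_has_derivative[OF F[OF that(1)] that(2)]] by (simp add: D_def)
  have split: "D i y (q, u) = D i y (q, 0) + D i y (0, u)" if "i \<in> {1..m}" "y \<in> S" for i y q u
    using linear_add[OF linD[OF that], of "(q, 0)" "(0, u)"] by simp
  have linl: "linear (\<lambda>u. D i y (0, u))" if "i \<in> {1..m}" "y \<in> S" for i y
    using linear_add[OF linD[OF that], of "(0, _)" "(0, _)"] linear_scale[OF linD[OF that], of _ "(0, _)"]
    by (intro linearI) auto
  have smD: "smooth_on T (\<lambda>y. D i y (h y))"
    if "i \<in> {1..m}" "open T" "T \<subseteq> S" "smooth_on T h" for i T h
    unfolding D_def
    by (rule smooth_on_frechet_apply[OF fdN that(2) F[OF that(1)] that(4) smooth_on_linear[OF bounded_linear_ident that(2)]])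
      (use that(3) in auto)
  \<comment> \<open>The frame is dual to the derivatives in the vertical directions (0, u), which
    are the fibre derivatives in coordinates; their independence at v starts the
    construction.\<close>
  have "\<exists>T e. open T \<and> snd k v \<in> T \<and> T \<subseteq> S \<and> (\<forall>j\<in>{1..m}. smooth_on T (e j)) \<and>
      (\<forall>y\<in>T. \<forall>i\<in>{1..m}. \<forall>j\<in>{1..m}. D i y (0, e j y) = (if i = j then 1 else 0))"
  proof (rule smooth_dual_frame[OF _ S, where l = "\<lambda>i y u. D i y (0, u)"])
    show "smooth_on T (\<lambda>y. D i y (0, w y))"
      if "i \<in> {1..m}" "open T" "T \<subseteq> S" "smooth_on T w" for i T w
      using that by (intro smD smooth_on_Pair smooth_on_const)
    fix a :: "nat \<Rightarrow> real" assume a: "\<forall>u. (\<Sum>i\<in>{1..m}. a i * D i (snd k v) (0, u)) = 0"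
    have "(\<Sum>i\<in>{1..m}. a i * fibre_derivative A (f i) v u) = 0" if u: "u \<in> tangent_space A (fst v)" for u
    proof -
      have "fibre_derivative A (f i) v u = D i (snd k v) (0, snd u c)" if "i \<in> {1..m}" for i
        unfolding D_def F_def k_def
        by (rule fibre_derivative_chart[OF fd A P[unfolded N_def] f[OF that, unfolded N_def] v cv u])
      then have "(\<Sum>i\<in>{1..m}. a i * fibre_derivative A (f i) v u) = (\<Sum>i\<in>{1..m}. a i * D i (snd k v) (0, snd u c))"
        by (intro sum.cong) auto
      then show ?thesis using a by simp
    qed
    then show "\<forall>i\<in>{1..m}. a i = 0"
      using assms(5)[OF v] unfolding independent_covectors_def by blast
  qed (use linl in auto)
  then obtain T e where T: "open T" "snd k v \<in> T" "T \<subseteq> S"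
    and e: "\<And>j. j \<in> {1..m} \<Longrightarrow> smooth_on T (e j)"
    and dual: "\<And>y i j. y \<in> T \<Longrightarrow> i \<in> {1..m} \<Longrightarrow> j \<in> {1..m} \<Longrightarrow> D i y (0, e j y) = (if i = j then 1 else 0)"
    by metis
  \<comment> \<open>Solves D_i (0, a) = - D_i (v, 0) with v = \<open>snd y\<close>: in the dual
    frame, the coefficient of \<open>e j\<close> is the right-hand side of the j-th
    equation.\<close>
  define a where "a y = - (\<Sum>j\<in>{1..m}. D j y (snd y, 0) *\<^sub>R e j y)" for y
  define X where "X y = (snd y, a y)" for y
  have sm_snd: "smooth_on T (snd :: 'e \<times> 'e \<Rightarrow> 'e)" by (rule smooth_on_linear[OF bounded_linear_snd T(1)])
  have "smooth_on T X"
    unfolding X_def a_def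
    by (intro smooth_on_Pair smooth_on_uminus smooth_on_sum smooth_on_scaleR T(1) sm_snd smD T(3) smooth_on_const e)
  have DX: "D i y (X y) = 0" if i: "i \<in> {1..m}" and y: "y \<in> T" for i y
  proof -
    interpret l: linear "\<lambda>u. D i y (0, u)" using linl[OF i, of y] y T(3) by auto
    have "D i y (0, a y) = - (\<Sum>j\<in>{1..m}. D j y (snd y, 0) * D i y (0, e j y))"
      unfolding a_def by (simp only: l.neg l.sum l.scale real_scaleR_def)
    also have "(\<Sum>j\<in>{1..m}. D j y (snd y, 0) * D i y (0, e j y)) = (\<Sum>j\<in>{1..m}. if i = j then D j y (snd y, 0) else 0)"
      by (intro sum.cong) (auto simp: dual[OF y i])
    also have "\<dots> = D i y (snd y, 0)" using i by simp
    finally show ?thesis using split[OF i, of y "snd y" "a y"] y T(3) by (auto simp: X_def)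
  qed
  define W where "W = {w \<in> fst k. snd k w \<in> T}"
  define Z where "Z w = tangent_of N k w (X (snd k w))" for w
  have kW: "k \<in> charts_at N w" if "w \<in> W" for w using that k_at by (simp add: W_def)
  \<comment> \<open>A point with coordinates in T shares them with a point of P, and k is
    injective.\<close>
  have WP: "W \<subseteq> P"
  proof
    fix w assume w: "w \<in> W"
    then obtain w' where "w' \<in> P \<inter> fst k" "snd k w = snd k w'" using T(3) by (auto simp: W_def S_def)
    then show "w \<in> P" using w smooth_atlasD(1)[OF N kN kN] unfolding W_def inj_on_def by blast
  qed
  have vf: "vector_field_on N W Z"
    unfolding W_def Z_def
    by (rule vector_field_onI[OF N kN T(1) _ \<open>smooth_on T X\<close>]) (use T(3) in \<open>auto simp: S_def\<close>)
  then have ZT: "Z w \<in> tangent_space N w" if "w \<in> W" for w using that by (simp add: vector_field_on_def)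
  have Zk: "snd (Z w) k = X (snd k w)" if "w \<in> W" for w
    unfolding Z_def by (rule tangent_of_coord[OF N kW[OF that]])
  have lvf: "local_vector_field N P v W Z"
    using vf WP T(2) vk by (simp add: local_vector_field_def W_def)
  have so: "second_order A W Z"
  proof (rule second_orderI[OF fd A])
    show "W \<subseteq> tangent_bundle A" using WP PB by auto
    show "Z w \<in> tangent_space (tangent_atlas A) w" if "w \<in> W" for w using ZT[OF that] by (simp add: N_def)
    show "\<exists>c\<in>charts_at A (fst w). fst (snd (Z w) (tangent_chart A c)) = snd w c" if "w \<in> W" for w
      by (rule bexI[of _ c]) (use Zk[OF that] that fst_k[of w] in \<open>auto simp: k_def X_def W_def\<close>)
  qed
  have cm: "constant_of_motion N W Z (f i)" if i: "i \<in> {1..m}" for i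
  proof (rule constant_of_motionI[OF fdN N P f[OF i] WP ZT])
    fix w assume w: "w \<in> W"
    show "\<exists>k\<in>charts_at N w. frechet_derivative (f i \<circ> chart_inv k) (at (snd k w)) (snd (Z w) k) = 0"
      by (rule bexI[OF _ kW[OF w]]) (use DX[OF i, of "snd k w"] Zk[OF w] w in \<open>simp add: D_def F_def W_def\<close>)
  qed
  \<comment> \<open>Each common point is treated separately. W' may reach beyond the domain of k,
    but w lies in W and hence in that domain.\<close>
  have "Z' w = Z w" if Z': "local_vector_field N P v W' Z'" "second_order A W' Z'"
      "\<forall>i\<in>{1..m}. constant_of_motion N W' Z' (f i)" and w: "w \<in> W" "w \<in> W'" for W' Z' w
  proof -
    have vf': "vector_field_on N W' Z'" and WP': "W' \<subseteq> P" using Z'(1) by (auto simp: local_vector_field_def)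
    have ZT': "Z' w \<in> tangent_space N w" using vf' w(2) by (simp add: vector_field_on_def)
    define y where "y = snd k w"
    have y: "y \<in> T" "y \<in> S" using w(1) T(3) by (auto simp: W_def y_def)
    define b where "b = snd (snd (Z' w) k)"
    \<comment> \<open>The second-order condition fixes the base half, so the fields can differ only
      in the vertical half b.\<close>
    have "fst (snd (Z' w) k) = snd y"
      using second_orderD[OF fd A Z'(2) w(2) _ _, of c] ZT' fst_k[of w] w(1) by (simp add: y_def W_def k_def N_def)
    then have Z'k: "snd (Z' w) k = (snd y, b)" by (simp add: b_def prod_eq_iff)
    have "D i y (0, b - a y) = 0" if i: "i \<in> {1..m}" for i
    proof -
      have "D i y (snd y, b) = 0"
        using constant_of_motionD[OF fdN N P f[OF i] WP' vf' _ w(2) kW[OF w(1)]] Z'(3) i Z'k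
        by (simp add: D_def F_def y_def)
      then have "D i y (0, b) = D i y (0, a y)"
        using DX[OF i y(1)] split[OF i y(2), of "snd y" b] split[OF i y(2), of "snd y" "a y"] by (simp add: X_def)
      then show ?thesis using linear_diff[OF linl[OF i y(2)], of b "a y"] by simp
    qed
    \<comment> \<open>The m functionals have a dual family in a space of dimension m, so they vanish
      jointly only at 0.\<close>
    then have "b - a y = 0"
      by (intro dual_family_separates[where J = "{1..m}", OF B(1,2) _ _ linl[OF _ y(2)] dual[OF y(1)]])
        (simp_all add: B(3))
    then have "snd (Z' w) k = snd (Z w) k" using Z'k Zk[OF w(1)] by (simp add: X_def y_def)
    then show ?thesis by (rule tangent_space_eqI[OF ZT' ZT[OF w(1)] kW[OF w(1)]])
  qed
  with lvf so cm show ?thesis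
    unfolding N_def by (intro exI[of _ W] exI[of _ Z]) blast
qed

end
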